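(* Let $\widehat X$ be a stationary Poisson hyperplane process in $\mathbb{R}^d$ whose intensity measure $\widehat\Theta$ is locally finite and not identically zero, let $\widehat\varphi$ be its spherical directional distribution, and let $X$ be the mosaic (set of cells) induced by $\widehat X$. Assume (A) the support of $\widehat\varphi$ is the whole unit sphere $\mathbb{S}^{d-1}$, and (B) $\widehat\varphi(u^\perp\cap\mathbb{S}^{d-1})=0$ for every unit vector $u\in\mathbb{S}^{d-1}$ (that is, $\widehat\varphi$ assigns measure zero to each great subsphere). Then, with probability one, for every simple $d$-polytope $P$ there are infinitely many cells of $X$ that are combinatorially isomorphic to $P$.
   Context: $\mathcal{H}^d$ is the space of (affine) hyperplanes in $\mathbb{R}^d$ with its usual topology and Borel $\sigma$-algebra $\mathcal{B}(\mathcal{H}^d)$. A stationary Poisson hyperplane process $\widehat X$ is a Poisson point process in $\mathcal{H}^d$ whose distribution is invariant under translations of $\mathbb{R}^d$. Realizations are identified with locally finite systems of hyperplanes (every bounded subset of $\mathbb{R}^d$ is met by only finitely many of them). Its intensity measure is $\widehat\Theta(A)=\mathbb{E}|\widehat X\cap A|$ for $A\in\mathcal{B}(\mathcal{H}^d)$, where $|\cdot|$ is the number of elements. The Poisson property means: $\mathbb{P}\{|\widehat X\cap A|=n\}=e^{-\widehat\Theta(A)}\widehat\Theta(A)^n/n!$ for $n\in\mathbb{N}_0$ whenever $\widehat\Theta(A)<\infty$, and the restrictions of $\widehat X$ to pairwise disjoint Borel sets are independent. By stationarity there are a number $\widehat\gamma>0$ and an even Borel probability measure $\widehat\varphi$ on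 the unit sphere $\mathbb{S}^{d-1}$, called the spherical directional distribution of $\widehat X$, such that $$\widehat\Theta(A)=\widehat\gamma\int_{\mathbb{S}^{d-1}}\int_{-\infty}^{\infty}\mathbf{1}_A(u^\perp+\tau u)\,d\tau\,\widehat\varphi(du),\qquad A\in\mathcal{B}(\mathcal{H}^d),$$ where $u^\perp$ is the hyperplane through $0$ orthogonal to $u$. The cells induced by a locally finite system $\mathcal{H}$ of hyperplanes are the closures of the connected components of $\mathbb{R}^d\setminus\bigcup_{H\in\mathcal{H}}H$. The mosaic $X$ is the (random) set of all cells induced by $\widehat X$. A $d$-polytope is a convex polytope of dimension $d$ in $\mathbb{R}^d$; it is simple if each of its vertices lies in exactly $d$ facets. Two polytopes are combinatorially isomorphic if their face lattices are isomorphic. *)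

theory Defs
  imports "HOL-Probability.Probability"
begin

section \<open>The space of affine hyperplanes\<close>

text \<open>For a unit vector \<open>u\<close> this is the hyperplane \<open>u\<^sup>\<bottom> + \<tau> u\<close>.\<close>

definition hyperplane_at :: "'a::euclidean_space \<Rightarrow> real \<Rightarrow> 'a set" where
  "hyperplane_at u \<tau> = (\<lambda>y. y + \<tau> *\<^sub>R u) ` {y. u \<bullet> y = 0}"

definition hyperplanes :: "'a::euclidean_space set set" where
  "hyperplanes = {H. affine H \<and> aff_dim H = int (DIM('a)) - 1}"

text \<open>The usual topology on the space of hyperplanes: the quotient topology with respect to
  the parametrization \<open>(u, \<tau>) \<mapsto> u\<^sup>\<bottom> + \<tau> u\<close>, \<open>u\<close> in the unit sphere and \<open>\<tau>\<close> real.\<close>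

definition hyperplane_topology :: "'a::euclidean_space set topology" where
  "hyperplane_topology = topology (\<lambda>U. U \<subseteq> hyperplanes \<and>
     openin (top_of_set (sphere 0 1 \<times> UNIV))
       {p \<in> sphere 0 1 \<times> UNIV. case_prod hyperplane_at p \<in> U})"

definition hyperplane_borel :: "'a::euclidean_space set measure" where
  "hyperplane_borel = sigma hyperplanes {U. openin hyperplane_topology U}"

lemma hyperplane_at_eq:
  fixes u :: "'a::euclidean_space"
  assumes "norm u = 1"
  shows "hyperplane_at u \<tau> = {x. u \<bullet> x = \<tau>}"
proof -
  have uu: "u \<bullet> u = 1"
    using assms by (simp add: norm_eq_1)
  have "x \<in> hyperplane_at u \<tau>" if "u \<bullet> x = \<tau>" for x
    unfolding hyperplane_at_def
    by (rule image_eqI[where x = "x - \<tau> *\<^sub>R u"]) (use that uu in \<open>auto simp: inner_diff_right\<close>)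
  then show ?thesis
    using uu by (auto simp: hyperplane_at_def inner_add_right)
qed

lemma hyperplanes_eq_image:
  "hyperplanes = case_prod hyperplane_at ` (sphere (0::'a::euclidean_space) 1 \<times> UNIV)"
proof (intro equalityI subsetI)
  fix H :: "'a set" assume "H \<in> hyperplanes"
  then have H: "affine H" "aff_dim H = int (DIM('a)) - 1"
    by (auto simp: hyperplanes_def)
  obtain a b where ab: "a \<noteq> 0" "affine hull H = {x. a \<bullet> x = b}"
    using H(2) aff_dim_eq_hyperplane[of H] by auto
  define u where "u = a /\<^sub>R norm a"
  have u: "norm u = 1"
    using ab(1) by (simp add: u_def)
  have "H = {x. u \<bullet> x = b / norm a}"
  proof -
    have "H = {x. a \<bullet> x = b}"
      using ab(2) H(1) affine_hull_eq[of H] by simp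
    moreover have "u \<bullet> x = a \<bullet> x / norm a" for x
      by (simp add: u_def divide_inverse mult.commute)
    ultimately show ?thesis
      using ab(1) by simp
  qed
  then have "H = hyperplane_at u (b / norm a)"
    by (simp only: hyperplane_at_eq[OF u])
  then show "H \<in> case_prod hyperplane_at ` (sphere 0 1 \<times> UNIV)"
    using u by (intro image_eqI[where x = "(u, b / norm a)"]) auto
next
  fix H :: "'a set" assume "H \<in> case_prod hyperplane_at ` (sphere 0 1 \<times> UNIV)"
  then obtain u \<tau> where u: "norm u = 1" "H = hyperplane_at u \<tau>"
    by auto
  moreover from u have "u \<noteq> 0" by auto
  ultimately show "H \<in> hyperplanes"
    by (auto simp: hyperplanes_def hyperplane_at_eq affine_hyperplane)
qed

lemma openin_hyperplane_topology:
  "openin hyperplane_topology U \<longleftrightarrow> U \<subseteq> hyperplanes \<and>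
     openin (top_of_set (sphere (0::'a::euclidean_space) 1 \<times> UNIV))
       {p \<in> sphere 0 1 \<times> UNIV. case_prod hyperplane_at p \<in> U}"
proof -
  let ?P = "sphere (0::'a) 1 \<times> (UNIV::real set)"
  let ?v = "\<lambda>U. {p \<in> ?P. case_prod hyperplane_at p \<in> U}"
  have "istopology (\<lambda>U. U \<subseteq> hyperplanes \<and> openin (top_of_set ?P) (?v U))"
    unfolding istopology_def
  proof (intro conjI allI impI)
    fix S T assume "S \<subseteq> hyperplanes \<and> openin (top_of_set ?P) (?v S)"
      "T \<subseteq> hyperplanes \<and> openin (top_of_set ?P) (?v T)"
    moreover have "?v (S \<inter> T) = ?v S \<inter> ?v T" by auto
    ultimately show "S \<inter> T \<subseteq> hyperplanes" "openin (top_of_set ?P) (?v (S \<inter> T))"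
      by (auto intro: openin_Int)
  next
    fix K assume K: "\<forall>U\<in>K. U \<subseteq> hyperplanes \<and> openin (top_of_set ?P) (?v U)"
    then show "\<Union>K \<subseteq> hyperplanes" by auto
    have "?v (\<Union>K) = \<Union>(?v ` K)" by auto
    then show "openin (top_of_set ?P) (?v (\<Union>K))"
      using K by auto
  qed
  then show ?thesis
    by (simp add: hyperplane_topology_def topology_inverse')
qed

lemma topspace_hyperplane_topology: "topspace hyperplane_topology = hyperplanes"
proof (rule antisym)
  show "topspace hyperplane_topology \<subseteq> hyperplanes"
    by (auto simp: topspace_def openin_hyperplane_topology)
  have "{p \<in> sphere (0::'a) 1 \<times> UNIV. case_prod hyperplane_at p \<in> hyperplanes} = sphere 0 1 \<times> UNIV"
    by (auto simp: hyperplanes_eq_image)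
  then have "openin hyperplane_topology (hyperplanes :: 'a set set)"
    unfolding openin_hyperplane_topology by simp
  then show "hyperplanes \<subseteq> topspace (hyperplane_topology :: 'a set topology)"
    by (rule openin_subset)
qed

lemma quotient_map_hyperplane_at:
  "quotient_map (top_of_set (sphere (0::'a::euclidean_space) 1 \<times> UNIV)) hyperplane_topology
     (case_prod hyperplane_at)"
  by (simp add: quotient_map_def topspace_hyperplane_topology openin_hyperplane_topology
      flip: hyperplanes_eq_image)


section \<open>Stationary Poisson hyperplane processes\<close>

definition locally_finite_system :: "'a::euclidean_space set set \<Rightarrow> bool" where
  "locally_finite_system \<H> \<longleftrightarrow>
     \<H> \<subseteq> hyperplanes \<and> (\<forall>B. bounded B \<longrightarrow> finite {H \<in> \<H>. H \<inter> B \<noteq> {}})"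

definition hyperplane_systems :: "'a::euclidean_space set set measure" where
  "hyperplane_systems = sigma {\<H>. locally_finite_system \<H>}
     {{\<H>. locally_finite_system \<H> \<and> finite (\<H> \<inter> A) \<and> card (\<H> \<inter> A) = n} | A n.
        A \<in> sets hyperplane_borel}"

definition hyperplane_process :: "'w measure \<Rightarrow> ('w \<Rightarrow> 'a::euclidean_space set set) \<Rightarrow> bool" where
  "hyperplane_process M X \<longleftrightarrow> prob_space M \<and> X \<in> M \<rightarrow>\<^sub>M hyperplane_systems"

text \<open>The counting measure of the whole type, \<open>emeasure (count_space UNIV)\<close>, yields the number
  of elements of an arbitrary set, with value \<open>\<infinity>\<close> on infinite sets.\<close>

definition intensity :: "'w measure \<Rightarrow> ('w \<Rightarrow> 'a::euclidean_space set set) \<Rightarrow> 'a set set \<Rightarrow> ennreal" where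
  "intensity M X A = (\<integral>\<^sup>+\<omega>. emeasure (count_space UNIV) (X \<omega> \<inter> A) \<partial>M)"

definition poisson_hyperplane_process ::
    "'w measure \<Rightarrow> ('w \<Rightarrow> 'a::euclidean_space set set) \<Rightarrow> bool" where
  "poisson_hyperplane_process M X \<longleftrightarrow>
     hyperplane_process M X \<and>
     (\<forall>A \<in> sets hyperplane_borel. intensity M X A < \<infinity> \<longrightarrow>
        (\<forall>n::nat. measure M {\<omega> \<in> space M. finite (X \<omega> \<inter> A) \<and> card (X \<omega> \<inter> A) = n} =
           exp (- enn2real (intensity M X A)) * enn2real (intensity M X A) ^ n / fact n)) \<and>
     (\<forall>A :: nat \<Rightarrow> 'a set set. range A \<subseteq> sets hyperplane_borel \<longrightarrow> disjoint_family A \<longrightarrow>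
        prob_space.indep_vars M (\<lambda>_. hyperplane_systems) (\<lambda>i \<omega>. X \<omega> \<inter> A i) UNIV)"

definition stationary :: "'w measure \<Rightarrow> ('w \<Rightarrow> 'a::euclidean_space set set) \<Rightarrow> bool" where
  "stationary M X \<longleftrightarrow>
     (\<forall>x. distr M hyperplane_systems (\<lambda>\<omega>. (\<lambda>H. (+) x ` H) ` X \<omega>) = distr M hyperplane_systems X)"

definition locally_finite_intensity ::
    "'w measure \<Rightarrow> ('w \<Rightarrow> 'a::euclidean_space set set) \<Rightarrow> bool" where
  "locally_finite_intensity M X \<longleftrightarrow>
     (\<forall>C. compactin hyperplane_topology C \<longrightarrow> intensity M X C < \<infinity>)"

definition even_sphere_prob :: "'a::euclidean_space measure \<Rightarrow> bool" where
  "even_sphere_prob \<phi> \<longleftrightarrow>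
     prob_space \<phi> \<and> sets \<phi> = sets (restrict_space borel (sphere 0 1)) \<and>
     (\<forall>A \<in> sets \<phi>. emeasure \<phi> (uminus ` A) = emeasure \<phi> A)"

definition spherical_directional_distribution ::
    "'w measure \<Rightarrow> ('w \<Rightarrow> 'a::euclidean_space set set) \<Rightarrow> 'a measure \<Rightarrow> bool" where
  "spherical_directional_distribution M X \<phi> \<longleftrightarrow>
     even_sphere_prob \<phi> \<and>
     (\<exists>\<gamma>::real. \<gamma> > 0 \<and>
       (\<forall>A \<in> sets hyperplane_borel. intensity M X A =
          ennreal \<gamma> * (\<integral>\<^sup>+u. (\<integral>\<^sup>+\<tau>. indicator A (hyperplane_at u \<tau>) \<partial>lborel) \<partial>\<phi>)))"

definition measure_support :: "'a::topological_space measure \<Rightarrow> 'a set" where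
  "measure_support \<mu> = {x \<in> space \<mu>. \<forall>U. open U \<longrightarrow> x \<in> U \<longrightarrow> emeasure \<mu> (U \<inter> space \<mu>) > 0}"


section \<open>Cells and combinatorial types of polytopes\<close>

definition cells :: "'a::euclidean_space set set \<Rightarrow> 'a set set" where
  "cells \<H> = closure ` components (UNIV - \<Union>\<H>)"

definition simple_d_polytope :: "'a::euclidean_space set \<Rightarrow> bool" where
  "simple_d_polytope P \<longleftrightarrow>
     polytope P \<and> aff_dim P = int (DIM('a)) \<and>
     (\<forall>v. v extreme_point_of P \<longrightarrow> card {F. F facet_of P \<and> v \<in> F} = DIM('a))"

text \<open>The relation \<open>face_of\<close> includes the empty face and the polytope itself, so the
  faces of a polytope ordered by inclusion form its face lattice.\<close>

definition combinatorially_isomorphic :: "'a::euclidean_space set \<Rightarrow> 'a set \<Rightarrow> bool" where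
  "combinatorially_isomorphic P Q \<longleftrightarrow>
     polytope P \<and> polytope Q \<and>
     (\<exists>f. bij_betw f {F. F face_of P} {G. G face_of Q} \<and>
          (\<forall>F G. F face_of P \<longrightarrow> G face_of P \<longrightarrow> (F \<subseteq> G \<longleftrightarrow> f F \<subseteq> f G)))"

end

theory Submission
  imports Defs
begin

text \<open>The combinatorial type of a simple polytope does not change when its facet hyperplanes are
  moved slightly (\<open>nearby_incidences_eq\<close>). Write the polytope as \<open>{x. \<forall>i<n. a i \<bullet> x \<le> b i}\<close> with one
  inequality for each facet. A polytope of the same type then appears as a cell near a point \<open>z\<close> as
  soon as the process has exactly one hyperplane in each of \<open>n\<close> small neighbourhoods of the facet
  hyperplanes, translated by \<open>z\<close>, and no other hyperplane that meets a certain ball around \<open>z\<close>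
  (\<open>cell_of_configuration\<close>). Since the directional distribution has full support, these
  neighbourhoods have positive intensity, the same for all \<open>z\<close>, and by the Poisson property the
  configuration has a probability that is bounded below by a positive number.

  To see infinitely many such configurations, one looks at a sequence of points on a line. The
  configurations at different points are not independent, because one hyperplane may meet several of
  the balls. Such a hyperplane is nearly parallel to the line, and the directional distribution
  gives measure zero to the great subsphere of directions orthogonal to the line. Therefore the
  expected number of hyperplanes meeting two of the balls tends to zero with growing distance
  of the balls, and for sufficiently sparse points the expected numbers of hyperplanes shared with
  earlier balls are summable. By the Borel--Cantelli lemma, only finitely many balls share a hyperplane
  with an earlier one. When the shared hyperplanes are disregarded, the configurations refer to
  disjoint sets of hyperplanes and become independent, and the zero-one law gives infinitely many of
  them (\<open>infinitely_many_configurations\<close>).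

  A single exceptional null set has to serve for all simple polytopes. The type of a polytope is
  therefore encoded by a finite set of finite sets of natural numbers: for each vertex, the indices
  of the inequalities that are tight there. This code determines the face lattice
  (\<open>combinatorially_isomorphic_if_incidences_eq\<close>), and there are only countably many codes.\<close>

section \<open>Vertex incidences determine the combinatorial type\<close>

definition hpoly :: "'i set \<Rightarrow> ('i \<Rightarrow> 'a::euclidean_space) \<Rightarrow> ('i \<Rightarrow> real) \<Rightarrow> 'a set" where
  "hpoly N a b = {x. \<forall>i\<in>N. a i \<bullet> x \<le> b i}"

definition active :: "'i set \<Rightarrow> ('i \<Rightarrow> 'a::euclidean_space) \<Rightarrow> ('i \<Rightarrow> real) \<Rightarrow> 'a \<Rightarrow> 'i set" where
  "active N a b x = {i\<in>N. a i \<bullet> x = b i}"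

text \<open>The vertex-facet incidences, recorded by indices only and thus without any metric information:
  the combinatorial invariant by which polytopes are compared.\<close>

definition incidences :: "'i set \<Rightarrow> ('i \<Rightarrow> 'a::euclidean_space) \<Rightarrow> ('i \<Rightarrow> real) \<Rightarrow> 'i set set" where
  "incidences N a b = active N a b ` {v. v extreme_point_of hpoly N a b}"

lemma active_subset: "active N a b x \<subseteq> N"
  by (auto simp: active_def)

lemma finite_active: "finite N \<Longrightarrow> finite (active N a b x)"
  by (rule finite_subset[OF active_subset])

lemma incidences_subset: "incidences N a b \<subseteq> Pow N"
  by (auto simp: incidences_def active_def)

lemma hpoly_eq_Inter: "hpoly N a b = (\<Inter>i\<in>N. {x. a i \<bullet> x \<le> b i})"
  by (auto simp: hpoly_def)

lemma convex_hpoly: "convex (hpoly N a b)"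
  unfolding hpoly_eq_Inter by (intro convex_INT convex_halfspace_le)

lemma closed_hpoly: "closed (hpoly N a b)"
  unfolding hpoly_eq_Inter by (intro closed_INT ballI closed_halfspace_le)

lemma polyhedron_hpoly: "finite N \<Longrightarrow> polyhedron (hpoly N a b)"
  unfolding hpoly_eq_Inter by (intro polyhedron_Inter) (auto simp: polyhedron_halfspace_le)

lemma compact_hpoly: "bounded (hpoly N a b) \<Longrightarrow> compact (hpoly N a b)"
  using closed_hpoly compact_eq_bounded_closed by blast

lemma polytope_hpoly: "finite N \<Longrightarrow> bounded (hpoly N a b) \<Longrightarrow> polytope (hpoly N a b)"
  by (simp add: polytope_eq_bounded_polyhedron polyhedron_hpoly)

text \<open>Inactive inequalities are strict at \<open>x\<close> and survive a short step in any direction; the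
  active ones only ask that the direction does not increase them.\<close>

lemma hpoly_extend:
  assumes N: "finite N" and x: "x \<in> hpoly N a b"
    and d: "\<And>i. i \<in> active N a b x \<Longrightarrow> a i \<bullet> d \<le> 0"
  obtains e where "e > 0" "x + e *\<^sub>R d \<in> hpoly N a b"
proof -
  have "\<forall>\<^sub>F t in at_right (0::real). \<forall>i\<in>N. a i \<bullet> (x + t *\<^sub>R d) \<le> b i"
  proof (rule eventually_ball_finite[OF N], intro ballI)
    fix i assume i: "i \<in> N"
    show "\<forall>\<^sub>F t in at_right (0::real). a i \<bullet> (x + t *\<^sub>R d) \<le> b i"
    proof (cases "i \<in> active N a b x")
      case True
      have "a i \<bullet> (x + t *\<^sub>R d) \<le> b i" if "t > 0" for t
        using True d[OF True] that by (auto simp: active_def inner_add_right mult_nonneg_nonpos)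
      then show ?thesis
        by (auto intro: eventually_at_rightI[of 0 1])
    next
      case False
      then have lt: "a i \<bullet> (x + 0 *\<^sub>R d) < b i"
        using x i by (force simp: hpoly_def active_def)
      have "((\<lambda>t. a i \<bullet> (x + t *\<^sub>R d)) \<longlongrightarrow> a i \<bullet> (x + 0 *\<^sub>R d)) (at_right 0)"
        by (intro tendsto_intros)
      then have "\<forall>\<^sub>F t in at_right (0::real). a i \<bullet> (x + t *\<^sub>R d) < b i"
        using lt by (rule order_tendstoD)
      then show ?thesis
        by (rule eventually_mono) simp
    qed
  qed
  then have "\<forall>\<^sub>F t in at_right (0::real). t > 0 \<and> x + t *\<^sub>R d \<in> hpoly N a b"
    using eventually_at_right_less[of "0::real"] by eventually_elim (auto simp: hpoly_def)
  then obtain e where "e > 0 \<and> x + e *\<^sub>R d \<in> hpoly N a b"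
    using eventually_happens[of _ "at_right (0::real)"] trivial_limit_at_right_real by blast
  then show ?thesis using that by blast
qed

lemma between_extension:
  fixes x y :: "'a::euclidean_space"
  assumes "e > 0" "x \<noteq> y"
  shows "x \<in> open_segment y (x + e *\<^sub>R (x - y))"
proof -
  have "x = (1 - 1/(1+e)) *\<^sub>R y + (1/(1+e)) *\<^sub>R (x + e *\<^sub>R (x - y))"
  proof -
    have "(1 - 1/(1+e)) *\<^sub>R y + (1/(1+e)) *\<^sub>R (x + e *\<^sub>R (x - y)) =
      (1 - 1/(1+e) - e/(1+e)) *\<^sub>R y + (1/(1+e) + e/(1+e)) *\<^sub>R x"
      by (simp add: algebra_simps)
    also have "1 - 1/(1+e) - e/(1+e) = 0"
      using assms by (simp add: field_simps)
    also have "1/(1+e) + e/(1+e) = 1"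
      using assms by (simp add: field_simps)
    finally show ?thesis by simp
  qed
  moreover have "y \<noteq> x + e *\<^sub>R (x - y)"
  proof
    assume "y = x + e *\<^sub>R (x - y)"
    then have "(1 + e) *\<^sub>R (x - y) = 0" by (simp add: algebra_simps)
    then show False using assms by auto
  qed
  moreover have "0 < 1/(1+e)" "1/(1+e) < 1" using assms by auto
  ultimately show ?thesis
    unfolding in_segment by blast
qed

text \<open>If \<open>w\<close> were another point with all the tight inequalities of \<open>v\<close>, then the segment from
  \<open>w\<close> to \<open>v\<close> could be prolonged beyond \<open>v\<close> inside the polyhedron, so \<open>v\<close> would not be extreme.
  Hence a vertex is determined by its active set.\<close>

lemma extreme_point_eqI:
  assumes N: "finite N" and v: "v extreme_point_of hpoly N a b" and w: "w \<in> hpoly N a b"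
    and sub: "active N a b v \<subseteq> active N a b w"
  shows "w = v"
proof (rule ccontr)
  assume "w \<noteq> v"
  have "v \<in> hpoly N a b" using v by (simp add: extreme_point_of_def)
  moreover have "a i \<bullet> (v - w) \<le> 0" if "i \<in> active N a b v" for i
    using that sub by (auto simp: active_def inner_diff_right)
  ultimately obtain e where "e > 0" "v + e *\<^sub>R (v - w) \<in> hpoly N a b"
    using hpoly_extend[OF N] by blast
  then show False
    using v w between_extension[of e v w] \<open>w \<noteq> v\<close> by (auto simp: extreme_point_of_def)
qed

text \<open>Moving from a vertex along a direction orthogonal to all active normals keeps the active
  inequalities tight. Hence the active normals span the space, which is what makes a vertex
  the unique solution of a regular linear system.\<close>

lemma extreme_point_normals_separate:
  assumes N: "finite N" and v: "v extreme_point_of hpoly N a b"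
    and x: "\<And>i. i \<in> active N a b v \<Longrightarrow> a i \<bullet> x = 0"
  shows "x = 0"
proof -
  have vin: "v \<in> hpoly N a b" using v by (simp add: extreme_point_of_def)
  then obtain e where e: "e > 0" "v + e *\<^sub>R x \<in> hpoly N a b"
    using hpoly_extend[OF N, of v a b x] x by (metis order_refl)
  have "v + e *\<^sub>R x = v"
  proof (rule extreme_point_eqI[OF N v e(2)])
    show "active N a b v \<subseteq> active N a b (v + e *\<^sub>R x)"
      using x by (auto simp: active_def inner_add_right)
  qed
  then show ?thesis using e(1) by simp
qed

lemma card_active_extreme_point:
  fixes a :: "'i \<Rightarrow> 'a::euclidean_space"
  assumes N: "finite N" and v: "v extreme_point_of hpoly N a b"
  shows "DIM('a) \<le> card (active N a b v)"
proof (rule ccontr)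
  assume "\<not> ?thesis"
  then have "card (a ` active N a b v) < DIM('a)"
    using card_image_le[OF finite_active[OF N], of a a b v] by linarith
  then have "dim (a ` active N a b v) < DIM('a)"
    using dim_le_card'[of "a ` active N a b v"] finite_active[OF N, of a b v] by fastforce
  then obtain x where x: "x \<noteq> 0" "span (a ` active N a b v) \<subseteq> {y. x \<bullet> y = 0}"
    using lowdim_subset_hyperplane by blast
  have "a i \<bullet> x = 0" if "i \<in> active N a b v" for i
    using x(2) span_base[of "a i" "a ` active N a b v"] that by (auto simp: inner_commute)
  then show False
    using extreme_point_normals_separate[OF N v] x(1) by blast
qed

lemma active_face_of: "{x \<in> hpoly N a b. J \<subseteq> active N a b x} face_of hpoly N a b"
proof (cases "J = {} \<or> \<not> J \<subseteq> N")
  case True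
  then have "{x \<in> hpoly N a b. J \<subseteq> active N a b x} = {} \<or>
      {x \<in> hpoly N a b. J \<subseteq> active N a b x} = hpoly N a b"
    by (auto simp: active_def)
  then show ?thesis
    by (metis empty_face_of face_of_refl[OF convex_hpoly])
next
  case False
  then have "{x \<in> hpoly N a b. J \<subseteq> active N a b x} = (\<Inter>i\<in>J. hpoly N a b \<inter> {x. a i \<bullet> x = b i})"
    by (auto simp: active_def)
  moreover have "(\<Inter>i\<in>J. hpoly N a b \<inter> {x. a i \<bullet> x = b i}) face_of hpoly N a b"
    using False
    by (intro face_of_Inter)
       (auto intro!: face_of_Int_supporting_hyperplane_le convex_hpoly, auto simp: hpoly_def)
  ultimately show ?thesis by simp
qed

text \<open>The index set is the active set of a relative interior point \<open>x\<close> of the face. From \<open>x\<close> one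
  can move both towards and away from any other point of the face, which forces equality in the
  inequalities active at \<open>x\<close>. Conversely, if those are tight at \<open>y\<close>, then the segment from \<open>y\<close> to
  \<open>x\<close> can be prolonged beyond \<open>x\<close>, and the definition of a face gives \<open>y\<close>.\<close>

lemma face_of_hpoly_eq:
  assumes N: "finite N" and F: "F face_of hpoly N a b" "F \<noteq> {}"
  obtains J where "F = {x \<in> hpoly N a b. J \<subseteq> active N a b x}"
proof -
  have cF: "convex F" using F(1) by (rule face_of_imp_convex)
  obtain x where x: "x \<in> rel_interior F"
    using rel_interior_eq_empty[OF cF] F(2) by blast
  then have xF: "x \<in> F" using rel_interior_subset by blast
  then have xP: "x \<in> hpoly N a b" using F(1) face_of_imp_subset by blast
  have FP: "y \<in> hpoly N a b" if "y \<in> F" for y using F(1) face_of_imp_subset that by blast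
  have "F = {y \<in> hpoly N a b. active N a b x \<subseteq> active N a b y}"
  proof (intro equalityI subsetI)
    fix y assume y: "y \<in> F"
    obtain e where e: "e > 1" "(1 - e) *\<^sub>R y + e *\<^sub>R x \<in> F"
      using convex_rel_interior_if2[OF cF x] hull_inc[OF y] by blast
    have "i \<in> active N a b y" if i: "i \<in> active N a b x" for i
    proof -
      have "(1 - e) * (a i \<bullet> y) + e * b i \<le> b i"
        using FP[OF e(2)] i by (auto simp: active_def hpoly_def inner_add_right)
      then have "(e - 1) * b i \<le> (e - 1) * (a i \<bullet> y)"
        by (simp add: algebra_simps)
      then have "b i \<le> a i \<bullet> y" using e(1) by simp
      then show ?thesis using FP[OF y] i by (auto simp: active_def hpoly_def intro: antisym)
    qed
    then show "y \<in> {y \<in> hpoly N a b. active N a b x \<subseteq> active N a b y}"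
      using FP[OF y] by blast
  next
    fix y assume "y \<in> {y \<in> hpoly N a b. active N a b x \<subseteq> active N a b y}"
    then have y: "y \<in> hpoly N a b" "active N a b x \<subseteq> active N a b y" by auto
    show "y \<in> F"
    proof (cases "y = x")
      case False
      have "a i \<bullet> (x - y) \<le> 0" if "i \<in> active N a b x" for i
        using that y(2) by (auto simp: active_def inner_diff_right)
      then obtain e where e: "e > 0" "x + e *\<^sub>R (x - y) \<in> hpoly N a b"
        using hpoly_extend[OF N xP] by blast
      then show ?thesis
        using F(1) xF y(1) between_extension[of e x y] False unfolding face_of_def by blast
    qed (use xF in simp)
  qed
  then show ?thesis using that by blast
qed

text \<open>The points at which the same inequalities are tight form a compact face, and an extreme
  point of that face is a vertex of the polytope.\<close>

lemma extreme_point_above: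
  assumes N: "finite N" and bd: "bounded (hpoly N a b)" and x: "x \<in> hpoly N a b"
  obtains v where "v extreme_point_of hpoly N a b" "active N a b x \<subseteq> active N a b v"
proof -
  let ?F = "{y \<in> hpoly N a b. active N a b x \<subseteq> active N a b y}"
  have F: "?F face_of hpoly N a b" by (rule active_face_of)
  have "compact ?F" "convex ?F"
    using face_of_imp_compact[OF convex_hpoly compact_hpoly[OF bd] F] face_of_imp_convex[OF F] by auto
  moreover have "?F \<noteq> {}" using x by blast
  ultimately obtain v where "v extreme_point_of ?F" using extreme_point_exists_convex by blast
  then show ?thesis
    using that extreme_point_of_face[OF F] by auto
qed

text \<open>Faces are encoded by the active sets of their vertices; since a face of a polytope is the
  convex hull of its vertices, this encoding reflects inclusion.\<close>

definition face_incidences :: "'i set \<Rightarrow> ('i \<Rightarrow> 'a::euclidean_space) \<Rightarrow> ('i \<Rightarrow> real) \<Rightarrow> 'a set \<Rightarrow> 'i set set" where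
  "face_incidences N a b F = active N a b ` {v. v extreme_point_of F}"

lemma face_incidences_mono_iff:
  assumes N: "finite N" and bd: "bounded (hpoly N a b)"
    and F: "F face_of hpoly N a b" and G: "G face_of hpoly N a b"
  shows "face_incidences N a b F \<subseteq> face_incidences N a b G \<longleftrightarrow> F \<subseteq> G"
proof
  assume "F \<subseteq> G"
  then show "face_incidences N a b F \<subseteq> face_incidences N a b G"
    by (auto simp: face_incidences_def extreme_point_of_face[OF F] extreme_point_of_face[OF G])
next
  assume le: "face_incidences N a b F \<subseteq> face_incidences N a b G"
  have "v extreme_point_of G" if v: "v extreme_point_of F" for v
  proof -
    obtain w where w: "w extreme_point_of G" "active N a b v = active N a b w"
      using le v unfolding face_incidences_def by blast
    then have "w = v"
      using v extreme_point_eqI[OF N, of v a b w]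
      by (auto simp: extreme_point_of_face[OF F] extreme_point_of_face[OF G]
               dest: extreme_point_of_def[THEN iffD1])
    then show ?thesis using w by simp
  qed
  moreover have "E = convex hull {v. v extreme_point_of E}" if "E face_of hpoly N a b" for E
    using that by (intro Krein_Milman_Minkowski face_of_imp_convex
        face_of_imp_compact[OF convex_hpoly compact_hpoly[OF bd]])
  ultimately show "F \<subseteq> G"
    using F G hull_mono[of "{v. v extreme_point_of F}" "{v. v extreme_point_of G}" convex] by auto
qed

text \<open>The codes of the faces can be listed from \<open>incidences N a b\<close> alone: the nonempty faces are
  cut out by index sets \<open>J\<close>, and the vertices on such a face are those whose active set contains
  \<open>J\<close>. The empty code accounts for the empty face.\<close>

lemma image_face_incidences:
  assumes N: "finite N"
  shows "face_incidences N a b ` {F. F face_of hpoly N a b} =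
    insert {} ((\<lambda>J. {A \<in> incidences N a b. J \<subseteq> A}) ` UNIV)"
proof -
  have *: "face_incidences N a b {x \<in> hpoly N a b. J \<subseteq> active N a b x} = {A \<in> incidences N a b. J \<subseteq> A}" for J
    by (auto simp: face_incidences_def incidences_def extreme_point_of_face[OF active_face_of]
             dest: extreme_point_of_def[THEN iffD1])
  show ?thesis
  proof (intro equalityI subsetI)
    fix S assume "S \<in> face_incidences N a b ` {F. F face_of hpoly N a b}"
    then obtain F where F: "F face_of hpoly N a b" "S = face_incidences N a b F" by blast
    show "S \<in> insert {} ((\<lambda>J. {A \<in> incidences N a b. J \<subseteq> A}) ` UNIV)"
    proof (cases "F = {}")
      case True
      then show ?thesis using F(2) by (simp add: face_incidences_def extreme_point_of_def)
    next
      case False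
      then obtain J where "F = {x \<in> hpoly N a b. J \<subseteq> active N a b x}"
        using face_of_hpoly_eq[OF N F(1)] by blast
      then show ?thesis using F(2) * by blast
    qed
  next
    fix S assume "S \<in> insert {} ((\<lambda>J. {A \<in> incidences N a b. J \<subseteq> A}) ` UNIV)"
    then consider "S = {}" | J where "S = {A \<in> incidences N a b. J \<subseteq> A}" by blast
    then show "S \<in> face_incidences N a b ` {F. F face_of hpoly N a b}"
    proof cases
      case 1
      then have "S = face_incidences N a b {}" by (simp add: face_incidences_def extreme_point_of_def)
      then show ?thesis by simp
    next
      case 2
      then show ?thesis using *[of J] active_face_of[of N a b J] by (metis (mono_tags, lifting) image_eqI mem_Collect_eq)
    qed
  qed
qed

text \<open>Both face lattices are order isomorphic to the same family of codes, ordered by inclusion.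
  The numbers of inequalities need not agree: an inequality that is never tight at a vertex
  leaves no trace in the incidences.\<close>

lemma combinatorially_isomorphic_if_incidences_eq:
  assumes N: "finite N" and bd: "bounded (hpoly N a b)"
    and N': "finite N'" and bd': "bounded (hpoly N' a' b')"
    and eq: "incidences N a b = incidences N' a' b'"
  shows "combinatorially_isomorphic (hpoly N a b) (hpoly N' a' b')"
proof -
  let ?P = "{F. F face_of hpoly N a b}" and ?Q = "{F. F face_of hpoly N' a' b'}"
  let ?p = "face_incidences N a b" and ?q = "face_incidences N' a' b'"
  define f where "f = the_inv_into ?Q ?q \<circ> ?p"
  have injp: "inj_on ?p ?P"
    using face_incidences_mono_iff[OF N bd] by (intro inj_onI) (metis antisym mem_Collect_eq order_refl)
  have injq: "inj_on ?q ?Q"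
    using face_incidences_mono_iff[OF N' bd'] by (intro inj_onI) (metis antisym mem_Collect_eq order_refl)
  have im: "?p ` ?P = ?q ` ?Q"
    by (simp add: image_face_incidences[OF N] image_face_incidences[OF N'] eq)
  have "bij_betw ?p ?P (?q ` ?Q)" using injp im by (simp add: bij_betw_def)
  then have bij: "bij_betw f ?P ?Q"
    unfolding f_def using injq
    by (intro bij_betw_trans bij_betw_the_inv_into) (simp_all add: bij_betw_def)
  have qf: "?q (f F) = ?p F" if "F \<in> ?P" for F
    unfolding f_def o_def using that im by (intro f_the_inv_into_f[OF injq]) blast
  have "F \<subseteq> G \<longleftrightarrow> f F \<subseteq> f G" if "F \<in> ?P" "G \<in> ?P" for F G
  proof -
    have "f F \<in> ?Q" "f G \<in> ?Q" using bij that by (auto simp: bij_betw_def)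
    then show ?thesis
      using face_incidences_mono_iff[OF N bd, of F G] face_incidences_mono_iff[OF N' bd', of "f F" "f G"]
        qf that by auto
  qed
  then show ?thesis
    unfolding combinatorially_isomorphic_def using polytope_hpoly[OF N bd] polytope_hpoly[OF N' bd'] bij
    by blast
qed

text \<open>Indexing by natural numbers leaves only countably many possible values of \<open>\<V>\<close>, so that
  statements that hold almost surely for each type hold almost surely for all types.\<close>

definition has_incidences :: "nat set set \<Rightarrow> 'a::euclidean_space set \<Rightarrow> bool" where
  "has_incidences \<V> C \<longleftrightarrow> (\<exists>N a b. finite N \<and> bounded (hpoly N a b) \<and> C = hpoly N a b \<and> incidences N a b = \<V>)"

lemma has_incidences_isomorphic:
  "has_incidences \<V> C \<Longrightarrow> has_incidences \<V> P \<Longrightarrow> combinatorially_isomorphic C P"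
  unfolding has_incidences_def using combinatorially_isomorphic_if_incidences_eq by metis

lemma countable_incidence_types: "countable {\<V> :: nat set set. finite \<V> \<and> \<V> \<subseteq> Collect finite}"
  by (intro countable_Collect_finite_subset countable_Collect_finite)

lemma incidences_in_types:
  "finite N \<Longrightarrow> incidences N a b \<in> {\<V>. finite \<V> \<and> \<V> \<subseteq> Collect finite}"
  using incidences_subset[of N a b] by (auto intro: finite_subset)


section \<open>Stability of simple polytopes under perturbation\<close>

text \<open>The filter of inequality systems that are uniformly close to \<open>(a, b)\<close> on \<open>N\<close>. In terms of it,
  perturbation statements become limits, and finitely many of them can be combined at once.\<close>

definition nearby :: "'i set \<Rightarrow> ('i \<Rightarrow> 'a::euclidean_space) \<Rightarrow> ('i \<Rightarrow> real)
    \<Rightarrow> (('i \<Rightarrow> 'a) \<times> ('i \<Rightarrow> real)) filter" where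
  "nearby N a b = (INF \<epsilon>\<in>{0<..}. principal
     {(a', b'). \<forall>i\<in>N. norm (a' i - a i) < \<epsilon> \<and> \<bar>b' i - b i\<bar> < \<epsilon>})"

lemma eventually_nearby:
  "eventually Q (nearby N a b) \<longleftrightarrow>
    (\<exists>\<epsilon>>0. \<forall>a' b'. (\<forall>i\<in>N. norm (a' i - a i) < \<epsilon> \<and> \<bar>b' i - b i\<bar> < \<epsilon>) \<longrightarrow> Q (a', b'))"
  unfolding nearby_def
proof (subst eventually_INF_base)
  fix x y :: real assume "x \<in> {0<..}" "y \<in> {0<..}"
  then show "\<exists>z\<in>{0<..}. principal {(a', b'). \<forall>i\<in>N. norm (a' i - a i) < z \<and> \<bar>b' i - b i\<bar> < z}
      \<le> inf (principal {(a', b'). \<forall>i\<in>N. norm (a' i - a i) < x \<and> \<bar>b' i - b i\<bar> < x})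
            (principal {(a', b'). \<forall>i\<in>N. norm (a' i - a i) < y \<and> \<bar>b' i - b i\<bar> < y})"
    by (intro bexI[of _ "min x y"]) auto
qed (auto simp: eventually_principal)

lemma tendsto_nearby:
  assumes "i \<in> N"
  shows "((\<lambda>p. fst p i) \<longlongrightarrow> a i) (nearby N a b)" "((\<lambda>p. snd p i) \<longlongrightarrow> b i) (nearby N a b)"
  using assms by (auto simp: tendsto_iff eventually_nearby dist_norm)

text \<open>The total violation \<open>g\<close> of the constraints is continuous and positive on the compact set,
  hence bounded away from zero, and it changes by little when the constraints do.\<close>

lemma nearby_infeasible_on_compact:
  assumes N: "finite N" "J \<subseteq> N" and K: "compact K"
    and empty: "\<And>x. x \<in> K \<Longrightarrow> x \<in> hpoly N a b \<Longrightarrow> J \<subseteq> active N a b x \<Longrightarrow> False"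
  shows "\<forall>\<^sub>F (a', b') in nearby N a b. \<forall>x\<in>K. x \<in> hpoly N a' b' \<longrightarrow> \<not> J \<subseteq> active N a' b' x"
proof (cases "K = {}")
  case False
  define g where "g x = (\<Sum>i\<in>N. max 0 (a i \<bullet> x - b i)) + (\<Sum>i\<in>J. \<bar>a i \<bullet> x - b i\<bar>)" for x
  have finJ: "finite J" using N finite_subset by blast
  have "continuous_on K g" unfolding g_def by (intro continuous_intros)
  then obtain x0 where x0: "x0 \<in> K" "\<And>x. x \<in> K \<Longrightarrow> g x0 \<le> g x"
    using continuous_attains_inf[OF K False] by blast
  have g0: "g x \<ge> 0" for x unfolding g_def by (intro add_nonneg_nonneg sum_nonneg) auto
  have "g x0 \<noteq> 0"
  proof
    assume "g x0 = 0"
    then have "(\<Sum>i\<in>N. max 0 (a i \<bullet> x0 - b i)) = 0" "(\<Sum>i\<in>J. \<bar>a i \<bullet> x0 - b i\<bar>) = 0"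
      unfolding g_def
      using add_nonneg_eq_0_iff[OF sum_nonneg[of N "\<lambda>i. max 0 (a i \<bullet> x0 - b i)"]
          sum_nonneg[of J "\<lambda>i. \<bar>a i \<bullet> x0 - b i\<bar>"]] by auto
    then have "\<forall>i\<in>N. max 0 (a i \<bullet> x0 - b i) = 0" "\<forall>i\<in>J. \<bar>a i \<bullet> x0 - b i\<bar> = 0"
      using N finJ by (auto simp: sum_nonneg_eq_0_iff)
    then have "x0 \<in> hpoly N a b" "J \<subseteq> active N a b x0"
      using N(2) by (auto simp: hpoly_def active_def max_def split: if_splits)
    then show False using empty x0(1) by blast
  qed
  then have gpos: "g x0 > 0" using g0[of x0] by linarith
  obtain B where B: "\<And>x. x \<in> K \<Longrightarrow> norm x \<le> B" "B > 0"
    using compact_imp_bounded[OF K] bounded_pos by metis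
  define q where "q = real (card N + card J + 1) * (B + 1)"
  have q: "q > 0" using B(2) by (simp add: q_def)
  \<comment> \<open>At a point of \<open>K\<close> that satisfies a nearby system, \<open>g\<close> is at most \<open>\<epsilon> * q\<close>, which is made
  smaller than the minimum of \<open>g\<close>.\<close>
  define \<epsilon> where "\<epsilon> = g x0 / (2 * q)"
  have eps: "\<epsilon> > 0" using gpos q by (simp add: \<epsilon>_def)
  show ?thesis
    unfolding eventually_nearby
  proof (intro exI[of _ \<epsilon>] conjI eps allI impI, clarify)
    fix a' b' x
    assume close: "\<forall>i\<in>N. norm (a' i - a i) < \<epsilon> \<and> \<bar>b' i - b i\<bar> < \<epsilon>"
      and x: "x \<in> K" "x \<in> hpoly N a' b'" "J \<subseteq> active N a' b' x"
    have diff: "\<bar>(a i \<bullet> x - b i) - (a' i \<bullet> x - b' i)\<bar> \<le> \<epsilon> * (B + 1)" if "i \<in> N" for i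
    proof -
      have "\<bar>(a' i - a i) \<bullet> x\<bar> \<le> norm (a' i - a i) * norm x" by (rule Cauchy_Schwarz_ineq2)
      also have "\<dots> \<le> \<epsilon> * B"
        using close that B(1)[OF x(1)] eps by (intro mult_mono) (auto intro: less_imp_le)
      finally have "\<bar>(a' i - a i) \<bullet> x\<bar> \<le> \<epsilon> * B" .
      moreover have "\<bar>b' i - b i\<bar> < \<epsilon>" using close that by blast
      ultimately show ?thesis by (simp add: inner_diff_left algebra_simps)
    qed
    have "(\<Sum>i\<in>N. max 0 (a i \<bullet> x - b i)) \<le> (\<Sum>i\<in>N. \<epsilon> * (B + 1))"
    proof (rule sum_mono)
      fix i assume i: "i \<in> N"
      then have "a' i \<bullet> x - b' i \<le> 0" using x(2) by (auto simp: hpoly_def)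
      moreover have "0 \<le> \<epsilon> * (B + 1)" using eps B(2) by simp
      ultimately show "max 0 (a i \<bullet> x - b i) \<le> \<epsilon> * (B + 1)"
        using diff[OF i] by linarith
    qed
    moreover have "(\<Sum>i\<in>J. \<bar>a i \<bullet> x - b i\<bar>) \<le> (\<Sum>i\<in>J. \<epsilon> * (B + 1))"
    proof (rule sum_mono)
      fix i assume "i \<in> J"
      then show "\<bar>a i \<bullet> x - b i\<bar> \<le> \<epsilon> * (B + 1)"
        using diff[of i] x(3) N(2) by (auto simp: active_def)
    qed
    ultimately have "g x \<le> (card N + card J) * (\<epsilon> * (B + 1))"
      by (simp add: g_def algebra_simps)
    also have "\<dots> \<le> real (card N + card J + 1) * (\<epsilon> * (B + 1))"
      using eps B(2) by (intro mult_right_mono) auto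
    also have "\<dots> = \<epsilon> * q" by (simp only: q_def mult_ac)
    also have "\<dots> = g x0 / 2" using q by (simp add: \<epsilon>_def)
    also have "\<dots> < g x0" using gpos by simp
    finally show False using x0(2)[OF x(1)] by linarith
  qed
qed (simp add: case_prod_unfold)

lemma nearby_strictly_feasible:
  assumes N: "finite N" and x: "\<And>i. i \<in> N \<Longrightarrow> a i \<bullet> x < b i"
  shows "\<forall>\<^sub>F (a', b') in nearby N a b. \<forall>i\<in>N. a' i \<bullet> x < b' i"
  unfolding case_prod_unfold
proof (rule eventually_ball_finite[OF N], intro ballI)
  fix i assume i: "i \<in> N"
  have "((\<lambda>p. fst p i \<bullet> x - snd p i) \<longlongrightarrow> a i \<bullet> x - b i) (nearby N a b)"
    using i by (intro tendsto_intros tendsto_nearby)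
  from order_tendstoD(2)[OF this, of 0] show "\<forall>\<^sub>F p in nearby N a b. fst p i \<bullet> x < snd p i"
    using x[OF i] by simp
qed

text \<open>On the sphere of radius \<open>R\<close> the system is infeasible, and stays so for nearby systems. A nearby
  polyhedron still contains \<open>x\<close>, and being connected it cannot leave the ball without crossing
  the sphere.\<close>

lemma nearby_subset_ball:
  assumes N: "finite N" and x: "\<And>i. i \<in> N \<Longrightarrow> a i \<bullet> x < b i"
    and sub: "hpoly N a b \<subseteq> ball 0 R"
  shows "\<forall>\<^sub>F (a', b') in nearby N a b. hpoly N a' b' \<subseteq> ball 0 R"
proof -
  have "x \<in> hpoly N a b" using x by (auto simp: hpoly_def less_imp_le)
  then have xR: "x \<in> ball 0 R" using sub by blast
  have "\<forall>\<^sub>F (a', b') in nearby N a b. \<forall>y\<in>sphere 0 R. y \<in> hpoly N a' b' \<longrightarrow> \<not> {} \<subseteq> active N a' b' y"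
    using sub by (intro nearby_infeasible_on_compact[OF N]) auto
  moreover have "\<forall>\<^sub>F (a', b') in nearby N a b. \<forall>i\<in>N. a' i \<bullet> x < b' i"
    using N x by (rule nearby_strictly_feasible)
  ultimately show ?thesis
  proof eventually_elim
    case (elim p)
    obtain a' b' where p: "p = (a', b')" by fastforce
    have "x \<in> hpoly N a' b'" using elim(2) p by (auto simp: hpoly_def less_imp_le)
    moreover have "hpoly N a' b' \<inter> frontier (ball 0 R) = {}"
      using elim(1) p xR by (auto simp: frontier_ball dest!: le_less_trans[OF norm_ge_zero])
    ultimately have "hpoly N a' b' - ball 0 R = {}"
      using connected_Int_frontier[OF convex_connected[OF convex_hpoly], of N a' b' "ball 0 R"] xR by blast
    then show ?case using p by auto
  qed
qed

text \<open>As many independent equations as there are dimensions form a linear system with an injective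
  coefficient map \<open>L a\<close>. The lower bound \<open>c * norm x \<le> norm (L a x)\<close> survives, halved, when the
  coefficients change by less than \<open>c / 2\<close>; so nearby systems remain solvable, and the same bound
  shows that their solutions tend to the original one.\<close>

lemma nearby_solution_tendsto:
  fixes a :: "'i \<Rightarrow> 'a::euclidean_space"
  assumes I: "finite I" "I \<subseteq> N" "card I = DIM('a)"
    and sep: "\<And>x. (\<And>i. i \<in> I \<Longrightarrow> a i \<bullet> x = 0) \<Longrightarrow> x = 0"
    and v: "\<And>i. i \<in> I \<Longrightarrow> a i \<bullet> v = b i"
  obtains s where "\<forall>\<^sub>F (a', b') in nearby N a b. \<forall>i\<in>I. a' i \<bullet> s (a', b') = b' i"
    and "(s \<longlongrightarrow> v) (nearby N a b)"
proof -
  obtain \<sigma> where \<sigma>: "bij_betw \<sigma> I (Basis :: 'a set)"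
    using finite_same_card_bij[OF I(1) finite_Basis I(3)] by blast
  \<comment> \<open>The equations as a linear map of the space into itself, via a numbering of the basis.\<close>
  define L where "L a' x = (\<Sum>i\<in>I. (a' i \<bullet> x) *\<^sub>R \<sigma> i)" for a' :: "'i \<Rightarrow> 'a" and x
  have linL: "linear (L a')" for a'
    unfolding L_def by (intro linearI)
      (simp_all add: inner_add_right scaleR_add_left sum.distrib scaleR_sum_right)
  have comp: "(\<Sum>i\<in>I. c i *\<^sub>R \<sigma> i) \<bullet> \<sigma> j = c j" if "j \<in> I" for c :: "'i \<Rightarrow> real" and j
  proof -
    have "(\<Sum>i\<in>I. c i *\<^sub>R \<sigma> i) \<bullet> \<sigma> j = (\<Sum>i\<in>I. if i = j then c i else 0)"
      unfolding inner_sum_left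
    proof (intro sum.cong refl)
      fix i assume "i \<in> I"
      then have "\<sigma> i \<in> Basis" "\<sigma> j \<in> Basis" "\<sigma> i = \<sigma> j \<longleftrightarrow> i = j"
        using \<sigma> that by (auto simp: bij_betw_def inj_on_def)
      then show "(c i *\<^sub>R \<sigma> i) \<bullet> \<sigma> j = (if i = j then c i else 0)"
        by (simp add: inner_Basis)
    qed
    then show ?thesis using that I(1) by simp
  qed
  have norm_le: "norm (\<Sum>i\<in>I. c i *\<^sub>R \<sigma> i) \<le> (\<Sum>i\<in>I. \<bar>c i\<bar>)" for c :: "'i \<Rightarrow> real"
  proof -
    have "norm (\<Sum>i\<in>I. c i *\<^sub>R \<sigma> i) \<le> (\<Sum>i\<in>I. norm (c i *\<^sub>R \<sigma> i))" by (rule norm_sum)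
    also have "\<dots> = (\<Sum>i\<in>I. \<bar>c i\<bar>)"
      using bij_betwE[OF \<sigma>] by (intro sum.cong) (simp_all add: norm_Basis)
    finally show ?thesis .
  qed
  have "inj (L a)"
  proof (rule linear_injective_0[OF linL, THEN iffD2], intro allI impI)
    fix x assume "L a x = 0"
    then show "x = 0" using comp[of _ "\<lambda>i. a i \<bullet> x"] by (intro sep) (auto simp: L_def)
  qed
  then obtain c where c: "c > 0" "\<And>x. c * norm x \<le> norm (L a x)"
    using linear_inj_bounded_below_pos[OF linL] by blast
  have "((\<lambda>p. \<Sum>i\<in>I. norm (fst p i - a i)) \<longlongrightarrow> (\<Sum>i\<in>I. norm (a i - a i))) (nearby N a b)"
    using I(2) by (intro tendsto_intros tendsto_nearby) auto
  then have ev: "\<forall>\<^sub>F p in nearby N a b. (\<Sum>i\<in>I. norm (fst p i - a i)) < c / 2"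
    by (rule order_tendstoD) (use c in simp)
  \<comment> \<open>The lower bound for the original system, halved by the perturbation.\<close>
  have below: "c / 2 * norm x \<le> norm (L a' x)" if "(\<Sum>i\<in>I. norm (a' i - a i)) < c / 2" for a' x
  proof -
    have "L a x - L a' x = (\<Sum>i\<in>I. ((a i - a' i) \<bullet> x) *\<^sub>R \<sigma> i)"
      by (simp add: L_def inner_diff_left scaleR_diff_left sum_subtractf)
    then have "norm (L a x - L a' x) \<le> (\<Sum>i\<in>I. \<bar>(a i - a' i) \<bullet> x\<bar>)" using norm_le by metis
    also have "\<dots> \<le> (\<Sum>i\<in>I. norm (a' i - a i) * norm x)"
      by (intro sum_mono) (metis Cauchy_Schwarz_ineq2 norm_minus_commute)
    also have "\<dots> \<le> c / 2 * norm x"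
      unfolding sum_distrib_right[symmetric] using that by (intro mult_right_mono) auto
    finally have "norm (L a x - L a' x) \<le> c / 2 * norm x" .
    then show ?thesis
      using c(2)[of x] norm_triangle_ineq2[of "L a x" "L a' x"] by (simp add: algebra_simps)
  qed
  have ex: "\<exists>x. L a' x = y" if "(\<Sum>i\<in>I. norm (a' i - a i)) < c / 2" for a' y
  proof -
    have "inj (L a')"
      using below[OF that] c(1)
      by (intro linear_injective_0[OF linL, THEN iffD2])
         (metis mult_eq_0_iff half_gt_zero less_irrefl mult_pos_pos norm_zero not_less zero_less_norm_iff)
    then have "surj (L a')" using linear_injective_imp_surjective[OF linL] by blast
    then show ?thesis by (metis surjD)
  qed
  define s where "s p = (SOME x. L (fst p) x = (\<Sum>i\<in>I. snd p i *\<^sub>R \<sigma> i))" for p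
  have s: "\<forall>\<^sub>F p in nearby N a b. L (fst p) (s p) = (\<Sum>i\<in>I. snd p i *\<^sub>R \<sigma> i)"
    using ev by eventually_elim (use ex in \<open>auto simp: s_def intro: someI_ex\<close>)
  show ?thesis
  proof (rule that[of s])
    show "\<forall>\<^sub>F (a', b') in nearby N a b. \<forall>i\<in>I. a' i \<bullet> s (a', b') = b' i"
      using s by eventually_elim (auto simp: L_def, metis comp)
    have "((\<lambda>p. 2 / c * (\<Sum>i\<in>I. \<bar>snd p i - fst p i \<bullet> v\<bar>)) \<longlongrightarrow>
        2 / c * (\<Sum>i\<in>I. \<bar>b i - a i \<bullet> v\<bar>)) (nearby N a b)"
      using I(2) by (intro tendsto_intros tendsto_nearby) auto
    then have lim: "((\<lambda>p. 2 / c * (\<Sum>i\<in>I. \<bar>snd p i - fst p i \<bullet> v\<bar>)) \<longlongrightarrow> 0) (nearby N a b)"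
      using v by simp
    have "\<forall>\<^sub>F p in nearby N a b. norm (s p - v) \<le> 2 / c * (\<Sum>i\<in>I. \<bar>snd p i - fst p i \<bullet> v\<bar>)"
      using ev s
    proof eventually_elim
      case (elim p)
      have "L (fst p) (s p - v) = (\<Sum>i\<in>I. (snd p i - fst p i \<bullet> v) *\<^sub>R \<sigma> i)"
        unfolding linear_diff[OF linL] elim(2) by (simp add: L_def scaleR_diff_left sum_subtractf)
      then have "c / 2 * norm (s p - v) \<le> (\<Sum>i\<in>I. \<bar>snd p i - fst p i \<bullet> v\<bar>)"
        using below[OF elim(1), of "s p - v"] norm_le[of "\<lambda>i. snd p i - fst p i \<bullet> v"] by simp
      then have "norm (s p - v) \<le> (\<Sum>i\<in>I. \<bar>snd p i - fst p i \<bullet> v\<bar>) / (c / 2)"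
        using c(1) by (subst pos_le_divide_eq) (simp_all add: mult.commute)
      then show ?case by (simp only: divide_divide_eq_right times_divide_eq_left mult.commute)
    qed
    then have "((\<lambda>p. s p - v) \<longlongrightarrow> 0) (nearby N a b)"
      using lim by (rule Lim_null_comparison)
    then show "(s \<longlongrightarrow> v) (nearby N a b)" by (rule LIM_zero_cancel)
  qed
qed

text \<open>This is where simplicity is used. A vertex \<open>v\<close> has exactly as many active inequalities
  as there are dimensions, so the perturbed equations again have a common solution near \<open>v\<close>, and
  the inactive inequalities remain strict there. No other active sets can arise: an index set
  whose equations have no common solution in the original polytope has none in a nearby one, so
  every active set of a nearby polytope is contained in some \<open>active N a b v\<close>; at a vertex it has
  at least \<open>DIM('a)\<close> elements, and then the two coincide.\<close>

proposition nearby_incidences_eq: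
  fixes a :: "'i \<Rightarrow> 'a::euclidean_space"
  assumes N: "finite N" and x: "\<And>i. i \<in> N \<Longrightarrow> a i \<bullet> x < b i"
    and bd: "bounded (hpoly N a b)"
    and simple: "\<And>v. v extreme_point_of hpoly N a b \<Longrightarrow> card (active N a b v) = DIM('a)"
  shows "\<forall>\<^sub>F (a', b') in nearby N a b. incidences N a' b' = incidences N a b"
proof -
  obtain R where R: "hpoly N a b \<subseteq> ball 0 R"
    using bd bounded_subset_ballD by blast
  have inball: "\<forall>\<^sub>F (a', b') in nearby N a b. hpoly N a' b' \<subseteq> ball 0 R"
    using N x R by (rule nearby_subset_ball)
  have "\<forall>\<^sub>F p in nearby N a b. \<forall>J\<in>{J \<in> Pow N. \<forall>y \<in> hpoly N a b. \<not> J \<subseteq> active N a b y}.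
      \<forall>y\<in>cball 0 R. y \<in> hpoly N (fst p) (snd p) \<longrightarrow> \<not> J \<subseteq> active N (fst p) (snd p) y"
  proof (rule eventually_ball_finite, goal_cases)
    case 2
    show ?case
    proof
    fix J assume "J \<in> {J \<in> Pow N. \<forall>y \<in> hpoly N a b. \<not> J \<subseteq> active N a b y}"
    then have J: "J \<subseteq> N" "\<And>y. y \<in> hpoly N a b \<Longrightarrow> J \<subseteq> active N a b y \<Longrightarrow> False" by auto
    have "\<forall>\<^sub>F (a', b') in nearby N a b. \<forall>y\<in>cball 0 R. y \<in> hpoly N a' b' \<longrightarrow> \<not> J \<subseteq> active N a' b' y"
      by (rule nearby_infeasible_on_compact[OF N J(1) compact_cball]) (rule J(2))
    then show "\<forall>\<^sub>F p in nearby N a b. \<forall>y\<in>cball 0 R. y \<in> hpoly N (fst p) (snd p) \<longrightarrow>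
        \<not> J \<subseteq> active N (fst p) (snd p) y"
      by (simp only: case_prod_unfold)
    qed
  qed (use N in auto)
  then have infeas: "\<forall>\<^sub>F (a', b') in nearby N a b. \<forall>J\<subseteq>N. (\<forall>y \<in> hpoly N a b. \<not> J \<subseteq> active N a b y) \<longrightarrow>
      (\<forall>y\<in>cball 0 R. y \<in> hpoly N a' b' \<longrightarrow> \<not> J \<subseteq> active N a' b' y)"
    by eventually_elim auto
  have "\<forall>\<^sub>F p in nearby N a b. \<forall>I\<in>incidences N a b. \<exists>y\<in>hpoly N (fst p) (snd p). I \<subseteq> active N (fst p) (snd p) y"
  proof (intro eventually_ball_finite ballI)
    show "finite (incidences N a b)"
      using N incidences_subset by (meson finite_Pow_iff finite_subset)
    fix I assume "I \<in> incidences N a b"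
    then obtain v where v: "v extreme_point_of hpoly N a b" "I = active N a b v"
      by (auto simp: incidences_def)
    have vin: "v \<in> hpoly N a b" using v by (simp add: extreme_point_of_def)
    have IN: "I \<subseteq> N" unfolding v(2) by (rule active_subset)
    obtain s where s: "\<forall>\<^sub>F (a', b') in nearby N a b. \<forall>i\<in>I. a' i \<bullet> s (a', b') = b' i"
        "(s \<longlongrightarrow> v) (nearby N a b)"
    proof (rule nearby_solution_tendsto[of I N a v b])
      show "finite I" "I \<subseteq> N" "card I = DIM('a)"
        using IN finite_subset N simple v by auto
      show "x = 0" if "\<And>i. i \<in> I \<Longrightarrow> a i \<bullet> x = 0" for x
        using extreme_point_normals_separate[OF N v(1)] that v(2) by blast
      show "a i \<bullet> v = b i" if "i \<in> I" for i using that v(2) by (simp add: active_def)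
    qed blast
    have "\<forall>\<^sub>F p in nearby N a b. \<forall>i\<in>N - I. fst p i \<bullet> s p < snd p i"
    proof (intro eventually_ball_finite ballI)
      fix i assume i: "i \<in> N - I"
      have "((\<lambda>p. fst p i \<bullet> s p - snd p i) \<longlongrightarrow> a i \<bullet> v - b i) (nearby N a b)"
        using i by (intro tendsto_intros tendsto_nearby s) auto
      moreover have "a i \<bullet> v < b i" using i vin v(2) by (force simp: hpoly_def active_def)
      ultimately show "\<forall>\<^sub>F p in nearby N a b. fst p i \<bullet> s p < snd p i"
        using order_tendstoD(2)[of _ "a i \<bullet> v - b i" _ 0] by fastforce
    qed (use N in auto)
    with s(1) show "\<forall>\<^sub>F p in nearby N a b. \<exists>y\<in>hpoly N (fst p) (snd p). I \<subseteq> active N (fst p) (snd p) y"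
    proof eventually_elim
      case (elim p)
      have *: "fst p i \<bullet> s p = snd p i" if "i \<in> I" for i using elim(1) that by (auto simp: case_prod_unfold)
      have "fst p i \<bullet> s p \<le> snd p i" if "i \<in> N" for i
        using *[of i] elim(2) that by (cases "i \<in> I") (auto intro: less_imp_le)
      then have "s p \<in> hpoly N (fst p) (snd p)" by (simp add: hpoly_def)
      moreover have "I \<subseteq> active N (fst p) (snd p) (s p)" using * IN by (auto simp: active_def)
      ultimately show ?case by blast
    qed
  qed
  then have feas: "\<forall>\<^sub>F (a', b') in nearby N a b. \<forall>I\<in>incidences N a b. \<exists>y\<in>hpoly N a' b'. I \<subseteq> active N a' b' y"
    by (simp add: case_prod_unfold)
  from inball infeas feas show ?thesis
  proof eventually_elim
    case (elim p)
    obtain a' b' where p: "p = (a', b')" by fastforce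
    have ball': "hpoly N a' b' \<subseteq> ball 0 R" using elim(1) p by simp
    have bd': "bounded (hpoly N a' b')" using ball' bounded_subset bounded_ball by blast
    have below: "\<exists>v. v extreme_point_of hpoly N a b \<and> active N a' b' y \<subseteq> active N a b v"
      if y: "y \<in> hpoly N a' b'" for y
    proof -
      have "y \<in> cball 0 R" using y ball' ball_subset_cball by blast
      then have "\<exists>z\<in>hpoly N a b. active N a' b' y \<subseteq> active N a b z"
        using elim(2) y active_subset[of N a' b' y] unfolding p prod.case by blast
      then obtain z where z: "z \<in> hpoly N a b" "active N a' b' y \<subseteq> active N a b z" by blast
      obtain v where "v extreme_point_of hpoly N a b" "active N a b z \<subseteq> active N a b v"
        by (rule extreme_point_above[OF N bd z(1)])
      with z(2) show ?thesis by (intro exI[of _ v] conjI) simp_all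
    qed
    have "incidences N a' b' \<subseteq> incidences N a b"
    proof
      fix I assume "I \<in> incidences N a' b'"
      then obtain w where w: "w extreme_point_of hpoly N a' b'" "I = active N a' b' w"
        by (auto simp: incidences_def)
      then obtain v where v: "v extreme_point_of hpoly N a b" "I \<subseteq> active N a b v"
        using below[of w] by (auto simp: extreme_point_of_def)
      have "card (active N a b v) \<le> card I"
        using simple[OF v(1)] card_active_extreme_point[OF N w(1)] w(2) by simp
      then have "I = active N a b v"
        using card_seteq[OF finite_active[OF N] v(2)] by blast
      then show "I \<in> incidences N a b" using v(1) by (auto simp: incidences_def)
    qed
    moreover have "incidences N a b \<subseteq> incidences N a' b'"
    proof
      fix I assume I: "I \<in> incidences N a b"
      then have cI: "card I = DIM('a)" using simple by (auto simp: incidences_def)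
      obtain y where y: "y \<in> hpoly N a' b'" "I \<subseteq> active N a' b' y"
        using elim(3) p I by auto
      obtain w where w: "w extreme_point_of hpoly N a' b'" "active N a' b' y \<subseteq> active N a' b' w"
        by (rule extreme_point_above[OF N bd' y(1)])
      obtain v where v: "v extreme_point_of hpoly N a b" "active N a' b' w \<subseteq> active N a b v"
        using below[of w] w(1) by (auto simp: extreme_point_of_def)
      have "I = active N a b v"
        using card_seteq[OF finite_active[OF N], of I a b v] y w v simple[OF v(1)] cI by auto
      then have "I = active N a' b' w" using y w v by blast
      then show "I \<in> incidences N a' b'" using w(1) by (auto simp: incidences_def)
    qed
    ultimately show ?case using p by simp
  qed
qed


section \<open>Cells and facet representations\<close>

lemma closure_strict_hpoly:
  assumes x: "\<And>i. i \<in> N \<Longrightarrow> a i \<bullet> x < b i"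
  shows "closure {y. \<forall>i\<in>N. a i \<bullet> y < b i} = hpoly N a b"
proof (intro equalityI subsetI)
  have "{y. \<forall>i\<in>N. a i \<bullet> y < b i} \<subseteq> hpoly N a b"
    by (auto simp: hpoly_def intro: less_imp_le)
  then show "y \<in> hpoly N a b" if "y \<in> closure {y. \<forall>i\<in>N. a i \<bullet> y < b i}" for y
    using that closure_minimal[OF _ closed_hpoly] by blast
next
  fix y assume y: "y \<in> hpoly N a b"
  define s where "s k = y + inverse (real (Suc k)) *\<^sub>R (x - y)" for k
  have "s \<longlonglongrightarrow> y + 0 *\<^sub>R (x - y)"
    unfolding s_def by (intro tendsto_intros LIMSEQ_inverse_real_of_nat)
  moreover have "\<forall>i\<in>N. a i \<bullet> s k < b i" for k
  proof
    fix i assume i: "i \<in> N"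
    define t where "t = inverse (real (Suc k))"
    have t: "0 < t" "t \<le> 1" by (auto simp: t_def field_simps)
    have "a i \<bullet> s k = (1 - t) * (a i \<bullet> y) + t * (a i \<bullet> x)"
      unfolding s_def t_def[symmetric] by (simp add: algebra_simps inner_add_right inner_diff_right)
    also have "\<dots> < (1 - t) * b i + t * b i"
      using t x[OF i] y i by (intro add_le_less_mono mult_left_mono mult_strict_left_mono) (auto simp: hpoly_def)
    finally show "a i \<bullet> s k < b i" by (simp add: algebra_simps)
  qed
  ultimately show "y \<in> closure {y. \<forall>i\<in>N. a i \<bullet> y < b i}"
    unfolding closure_sequential by (intro exI[of _ s]) simp
qed

text \<open>The strict inequalities describe a connected open set that avoids all hyperplanes. A larger
  connected set would meet its frontier, where one of the inequalities is tight, and so would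
  meet one of the bounding hyperplanes.\<close>

lemma hpoly_in_cells:
  assumes N: "finite N" and x: "\<And>i. i \<in> N \<Longrightarrow> a i \<bullet> x < b i"
    and sub: "hpoly N a b \<subseteq> U"
    and facets: "\<And>i. i \<in> N \<Longrightarrow> {y. a i \<bullet> y = b i} \<in> \<H>"
    and others: "\<And>H. H \<in> \<H> \<Longrightarrow> H \<inter> U \<noteq> {} \<Longrightarrow> \<exists>i\<in>N. H = {y. a i \<bullet> y = b i}"
  shows "hpoly N a b \<in> cells \<H>"
proof -
  let ?C = "{y. \<forall>i\<in>N. a i \<bullet> y < b i}"
  have C: "?C = (\<Inter>i\<in>N. {y. a i \<bullet> y < b i})" by auto
  have op: "open ?C" unfolding C using N by (intro open_INT) (auto simp: open_halfspace_lt)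
  have conv: "convex ?C" unfolding C by (intro convex_INT convex_halfspace_lt)
  have cl: "closure ?C = hpoly N a b" using x by (rule closure_strict_hpoly)
  have CU: "?C \<subseteq> U" using sub closure_subset[of ?C] unfolding cl by (rule order_trans[rotated])
  have xC: "x \<in> ?C" using x by simp
  have "?C \<in> components (UNIV - \<Union>\<H>)"
    unfolding in_components_maximal
  proof (intro conjI allI impI)
    show "?C \<noteq> {}" using xC by blast
    have False if y: "\<forall>i\<in>N. a i \<bullet> y < b i" "H \<in> \<H>" "y \<in> H" for y H
    proof -
      from y have "H \<inter> U \<noteq> {}" using CU by blast
      then obtain i where "i \<in> N" "H = {y. a i \<bullet> y = b i}" using others[OF y(2)] by blast
      then show False using y by force
    qed
    then show "?C \<subseteq> UNIV - \<Union>\<H>" by blast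
    show "connected ?C" using conv by (rule convex_connected)
  next
    fix D assume D: "D \<noteq> {} \<and> ?C \<subseteq> D \<and> D \<subseteq> UNIV - \<Union>\<H> \<and> connected D"
    show "D = ?C"
    proof (rule ccontr)
      assume "D \<noteq> ?C"
      then have "D - ?C \<noteq> {}" using D by blast
      moreover have "D \<inter> ?C \<noteq> {}" using D xC by blast
      ultimately have "D \<inter> frontier ?C \<noteq> {}" using D connected_Int_frontier[of D ?C] by simp
      then obtain w where w: "w \<in> D" "w \<in> hpoly N a b" "w \<notin> ?C"
        using cl interior_open[OF op] by (auto simp: frontier_def)
      then obtain i where "i \<in> N" "a i \<bullet> w = b i" by (force simp: hpoly_def)
      then show False using facets[of i] w(1) D by blast
    qed
  qed
  then show ?thesis unfolding cells_def using cl by blast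
qed

lemma facet_supporting_halfspace:
  fixes P :: "'a::euclidean_space set"
  assumes P: "polyhedron P" and F: "F facet_of P"
  shows "\<exists>a b. norm a = 1 \<and> P \<subseteq> {x. a \<bullet> x \<le> b} \<and> F = P \<inter> {x. a \<bullet> x = b}"
proof -
  have "F face_of P" "F \<noteq> {}" "F \<noteq> P"
    using F facet_of_irrefl by (auto simp: facet_of_def)
  moreover then have "F exposed_face_of P" using exposed_face_of_polyhedron[OF P] by blast
  ultimately obtain a b where ab: "P \<subseteq> {x. a \<bullet> x \<le> b}" "F = P \<inter> {x. a \<bullet> x = b}"
    unfolding exposed_face_of_def by blast
  have "a \<noteq> 0"
    using ab \<open>F \<noteq> {}\<close> \<open>F \<noteq> P\<close> by (cases "b = 0") auto
  then have na: "norm a > 0" by simp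
  have "(a /\<^sub>R norm a) \<bullet> x \<le> b / norm a \<longleftrightarrow> a \<bullet> x \<le> b"
    "(a /\<^sub>R norm a) \<bullet> x = b / norm a \<longleftrightarrow> a \<bullet> x = b" for x
    using na by (auto simp: field_simps)
  then show ?thesis
    using ab na by (intro exI[of _ "a /\<^sub>R norm a"] exI[of _ "b / norm a"]) auto
qed

text \<open>A point \<open>y\<close> outside the polytope that satisfies all facet inequalities would be joined to the
  interior point \<open>x\<close> by a segment that crosses the frontier in some facet, although the inequality
  of that facet is strict at \<open>x\<close> and hence strictly inside the segment. Indexing the inequalities
  by the facets themselves makes each facet occur exactly once, as needed for counting the facets
  through a vertex.\<close>

lemma polytope_facet_representation:
  fixes P :: "'a::euclidean_space set"
  assumes P: "polyhedron P" and x: "x \<in> interior P"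
    and half: "\<And>F. F facet_of P \<Longrightarrow> a F \<noteq> 0 \<and> P \<subseteq> {y. a F \<bullet> y \<le> b F} \<and> F = P \<inter> {y. a F \<bullet> y = b F}"
  shows "hpoly {F. F facet_of P} a b = P" "\<And>F. F facet_of P \<Longrightarrow> a F \<bullet> x < b F"
proof -
  show strict: "a F \<bullet> x < b F" if F: "F facet_of P" for F
  proof -
    obtain e where e: "e > 0" "cball x e \<subseteq> P" using x by (auto simp: mem_interior_cball)
    have aF: "a F \<noteq> 0" using half[OF F] by blast
    then have "x + (e / norm (a F)) *\<^sub>R a F \<in> P"
      using e by (intro subsetD[OF e(2)]) (simp add: dist_norm)
    then have "a F \<bullet> (x + (e / norm (a F)) *\<^sub>R a F) \<le> b F" using half[OF F] by blast
    then have "a F \<bullet> x + e / norm (a F) * (a F \<bullet> a F) \<le> b F" by (simp add: inner_add_right)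
    moreover have "e / norm (a F) * (a F \<bullet> a F) > 0" using e(1) aF by simp
    ultimately show ?thesis by linarith
  qed
  have xP: "x \<in> P" using x interior_subset by blast
  have hull: "affine hull P = UNIV"
    using x by (metis affine_hull_nonempty_interior empty_iff)
  have frontier: "frontier P = \<Union>{F. F facet_of P}"
    using rel_frontier_of_polyhedron[OF P] rel_frontier_frontier[OF hull] by simp
  show "hpoly {F. F facet_of P} a b = P"
  proof (intro equalityI subsetI)
    show "y \<in> hpoly {F. F facet_of P} a b" if "y \<in> P" for y
      using that half by (auto simp: hpoly_def)
  next
    fix y assume y: "y \<in> hpoly {F. F facet_of P} a b"
    show "y \<in> P"
    proof (rule ccontr)
      assume yP: "y \<notin> P"
      have "closed_segment x y \<inter> frontier P \<noteq> {}"
        using xP yP by (intro connected_Int_frontier) auto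
      then obtain w F where w: "w \<in> closed_segment x y" "F facet_of P" "w \<in> F"
        using frontier by blast
      then have wP: "w \<in> P" "a F \<bullet> w = b F" using half by auto
      obtain u where u: "0 \<le> u" "u \<le> 1" "w = (1 - u) *\<^sub>R x + u *\<^sub>R y"
        using w(1) by (auto simp: in_segment)
      have "u \<noteq> 1" using u(3) wP yP by auto
      have "b F = (1 - u) * (a F \<bullet> x) + u * (a F \<bullet> y)"
        using wP(2) u(3) by (simp add: inner_add_right)
      also have "\<dots> < (1 - u) * b F + u * b F"
        using u \<open>u \<noteq> 1\<close> strict[OF w(2)] y w(2)
        by (intro add_less_le_mono mult_left_mono mult_strict_left_mono) (auto simp: hpoly_def)
      finally show False by (simp add: algebra_simps)
    qed
  qed
qed

text \<open>The last two conditions say that the bounding hyperplanes are pairwise distinct, where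
  \<open>(u, t)\<close> and \<open>(- u, - t)\<close> describe the same hyperplane. Opposite signs are impossible because
  the polytope would then lie in a hyperplane.\<close>

lemma simple_d_polytope_hpoly:
  fixes P :: "'a::euclidean_space set"
  assumes "simple_d_polytope P"
  obtains n :: nat and a b x where "P = hpoly {..<n} a b" "\<And>i. i < n \<Longrightarrow> norm (a i) = 1"
    "bounded (hpoly {..<n} a b)" "\<And>i. i < n \<Longrightarrow> a i \<bullet> x < b i"
    "\<And>v. v extreme_point_of hpoly {..<n} a b \<Longrightarrow> card (active {..<n} a b v) = DIM('a)"
    "\<And>i j. i < n \<Longrightarrow> j < n \<Longrightarrow> (a i, b i) = (a j, b j) \<Longrightarrow> i = j"
    "\<And>i j. i < n \<Longrightarrow> j < n \<Longrightarrow> (a i, b i) \<noteq> (- a j, - b j)"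
proof -
  let ?FF = "{F. F facet_of P}"
  have P: "polytope P" "aff_dim P = int DIM('a)"
    and card: "\<And>v. v extreme_point_of P \<Longrightarrow> card {F. F facet_of P \<and> v \<in> F} = DIM('a)"
    using assms by (auto simp: simple_d_polytope_def)
  have polyh: "polyhedron P" using P(1) by (rule polytope_imp_polyhedron)
  have "P \<noteq> {}" using P(2) by auto
  then have "interior P \<noteq> {}"
    using interior_rel_interior[OF P(2)] rel_interior_eq_empty[OF polytope_imp_convex[OF P(1)]] by simp
  then obtain x where x: "x \<in> interior P" by blast
  have "\<forall>F. \<exists>a b. F facet_of P \<longrightarrow> norm a = 1 \<and> P \<subseteq> {x. a \<bullet> x \<le> b} \<and> F = P \<inter> {x. a \<bullet> x = b}"
    using facet_supporting_halfspace[OF polyh] by blast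
  then obtain A B where AB: "\<And>F. F facet_of P \<Longrightarrow>
      norm (A F) = 1 \<and> P \<subseteq> {x. A F \<bullet> x \<le> B F} \<and> F = P \<inter> {x. A F \<bullet> x = B F}"
    by metis
  have rep: "hpoly ?FF A B = P" "\<And>F. F facet_of P \<Longrightarrow> A F \<bullet> x < B F"
    using polytope_facet_representation[OF polyh x, of A B] AB by (metis norm_zero zero_neq_one)+
  obtain h where h: "bij_betw h {..<card ?FF} ?FF"
    using ex_bij_betw_nat_finite[OF finite_polytope_facets[OF P(1)]] by (auto simp: atLeast0LessThan)
  have hF: "h i facet_of P" if "i < card ?FF" for i using bij_betwE[OF h] that by auto
  define n a b where "n = card ?FF" and "a = A \<circ> h" and "b = B \<circ> h"
  have him: "h ` {..<n} = ?FF" using h by (simp add: bij_betw_def n_def)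
  have hp: "hpoly {..<n} a b = P"
  proof -
    have "hpoly {..<n} a b = hpoly (h ` {..<n}) A B" by (auto simp: hpoly_def a_def b_def)
    then show ?thesis using him rep(1) by simp
  qed
  show ?thesis
  proof (rule that[of n a b x])
    show "P = hpoly {..<n} a b" "bounded (hpoly {..<n} a b)"
      using hp polytope_imp_bounded[OF P(1)] by auto
    show "norm (a i) = 1" and strict: "a i \<bullet> x < b i" if "i < n" for i
      using AB[OF hF] rep(2)[OF hF] that by (auto simp: n_def a_def b_def)
    show "(a i, b i) \<noteq> (- a j, - b j)" if "i < n" "j < n" for i j
      using strict[OF that(1)] strict[OF that(2)] by auto
    show "i = j" if "i < n" "j < n" "(a i, b i) = (a j, b j)" for i j
    proof -
      have "h i = P \<inter> {x. A (h i) \<bullet> x = B (h i)}" "h j = P \<inter> {x. A (h j) \<bullet> x = B (h j)}"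
        using AB[OF hF] that by (auto simp: n_def)
      then have "h i = h j" using that(3) by (simp add: a_def b_def)
      then show ?thesis using h that by (auto simp: bij_betw_def inj_on_def n_def)
    qed
    show "card (active {..<n} a b v) = DIM('a)" if v: "v extreme_point_of hpoly {..<n} a b" for v
    proof -
      have vP: "v \<in> P" "v extreme_point_of P" using v hp by (auto simp: extreme_point_of_def)
      have mem: "a i \<bullet> v = b i \<longleftrightarrow> v \<in> h i" if "i < n" for i
      proof -
        have "h i = P \<inter> {x. A (h i) \<bullet> x = B (h i)}" using AB[OF hF] that by (auto simp: n_def)
        then show ?thesis using vP by (auto simp: a_def b_def)
      qed
      have "bij_betw h (active {..<n} a b v) {F. F facet_of P \<and> v \<in> F}"
        unfolding bij_betw_def
      proof
        show "inj_on h (active {..<n} a b v)"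
          using h active_subset[of "{..<n}" a b v] by (auto simp: bij_betw_def n_def intro: inj_on_subset)
        show "h ` active {..<n} a b v = {F. F facet_of P \<and> v \<in> F}"
        proof (intro equalityI subsetI)
          show "F \<in> {F. F facet_of P \<and> v \<in> F}" if "F \<in> h ` active {..<n} a b v" for F
            using that mem him by (auto simp: active_def)
          show "F \<in> h ` active {..<n} a b v" if F: "F \<in> {F. F facet_of P \<and> v \<in> F}" for F
          proof -
            obtain i where "i < n" "F = h i" using F him by (metis (no_types, lifting) imageE lessThan_iff mem_Collect_eq)
            then show ?thesis using mem F by (auto simp: active_def)
          qed
        qed
      qed
      then show ?thesis using card[OF vP(2)] by (simp add: bij_betw_same_card)
    qed
  qed
qed

lemma hpoly_translation:
  "hpoly N a (\<lambda>i. b i + a i \<bullet> z) = (+) z ` hpoly N a b"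
proof (intro equalityI subsetI)
  fix x assume "x \<in> hpoly N a (\<lambda>i. b i + a i \<bullet> z)"
  then have "x - z \<in> hpoly N a b" by (auto simp: hpoly_def inner_diff_right)
  then show "x \<in> (+) z ` hpoly N a b" by (metis add.commute diff_add_cancel image_eqI)
qed (auto simp: hpoly_def inner_add_right)

lemma incidences_translation: "incidences N a (\<lambda>i. b i + a i \<bullet> z) = incidences N a b"
proof -
  have "active N a (\<lambda>i. b i + a i \<bullet> z) (z + v) = active N a b v" for v
    by (auto simp: active_def inner_add_right)
  then show ?thesis
    unfolding incidences_def hpoly_translation extreme_points_of_translation image_image by simp
qed


section \<open>Infinitely many local configurations in a Poisson hyperplane process\<close>

lemma space_hyperplane_systems: "space hyperplane_systems = {\<H>. locally_finite_system \<H>}"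
  unfolding hyperplane_systems_def by (intro space_measure_of) auto

lemma sets_hyperplane_systems_count:
  assumes "A \<in> sets hyperplane_borel"
  shows "{\<H> \<in> space hyperplane_systems. finite (\<H> \<inter> A) \<and> card (\<H> \<inter> A) = m} \<in> sets hyperplane_systems"
proof -
  have "{\<H>. locally_finite_system \<H> \<and> finite (\<H> \<inter> A) \<and> card (\<H> \<inter> A) = m} \<in> sets hyperplane_systems"
    unfolding hyperplane_systems_def using assms by (subst sets_measure_of) auto
  then show ?thesis by (simp add: space_hyperplane_systems)
qed

text \<open>The unions of the tails of the events decrease to the limit superior and all have probability at
  least \<open>p\<close>.\<close>

lemma (in prob_space) not_AE_finitely_often:
  assumes meas: "\<And>k::nat. {\<omega>\<in>space M. P k \<omega>} \<in> events" and p: "p > 0"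
    and prob: "\<forall>\<^sub>F k in sequentially. p \<le> prob {\<omega>\<in>space M. P k \<omega>}"
  shows "\<not> (AE \<omega> in M. finite {k. P k \<omega>})"
proof
  assume fin: "AE \<omega> in M. finite {k. P k \<omega>}"
  define G where "G k = (\<Union>m\<in>{k..}. {\<omega>\<in>space M. P m \<omega>})" for k
  have Gm [measurable]: "G k \<in> events" for k unfolding G_def using meas by auto
  have "decseq G" unfolding decseq_def G_def by (auto intro: order_trans)
  then have lim: "(\<lambda>k. prob (G k)) \<longlonglongrightarrow> prob (\<Inter>k. G k)"
    using Gm by (intro finite_Lim_measure_decseq) auto
  have "AE \<omega> in M. \<omega> \<notin> (\<Inter>k. G k)"
    using fin
  proof eventually_elim
    case (elim \<omega>)
    then obtain k where "\<forall>m\<in>{m. P m \<omega>}. m < k"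
      using finite_nat_set_iff_bounded by auto
    then have "\<omega> \<notin> G k" by (auto simp: G_def not_le[symmetric])
    then show ?case by blast
  qed
  then have "prob (\<Inter>k. G k) = 0"
    by (subst prob_eq_0) (auto intro!: sets.countable_INT)
  moreover have "\<forall>\<^sub>F k in sequentially. p \<le> prob (G k)"
    using prob
  proof eventually_elim
    case (elim k)
    have "prob {\<omega>\<in>space M. P k \<omega>} \<le> prob (G k)"
      by (intro finite_measure_mono Gm) (auto simp: G_def)
    then show ?case using elim by simp
  qed
  ultimately have "p \<le> 0"
    using tendsto_lowerbound[OF lim] by simp
  then show False using p by simp
qed

text \<open>The intensity as a genuine measure \<open>\<Theta>\<close>: additivity and finiteness arguments can then use measure
  theory directly.\<close>

locale poisson_hyperplanes = prob_space M
  for M :: "'w measure" +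
  fixes X :: "'w \<Rightarrow> 'a::euclidean_space set set" and \<Theta> :: "'a set measure"
  assumes poisson: "poisson_hyperplane_process M X"
    and sets_intensity [simp]: "sets \<Theta> = sets hyperplane_borel"
    and emeasure_intensity: "\<And>A. A \<in> sets hyperplane_borel \<Longrightarrow> emeasure \<Theta> A = intensity M X A"
begin

lemma measurable_process: "X \<in> M \<rightarrow>\<^sub>M hyperplane_systems"
  using poisson by (simp add: poisson_hyperplane_process_def hyperplane_process_def)

lemma process_hyperplanes:
  assumes "\<omega> \<in> space M"
  shows "X \<omega> \<subseteq> hyperplanes"
  using measurable_space[OF measurable_process assms]
  by (simp add: space_hyperplane_systems locally_finite_system_def)

lemma count_event:
  assumes "A \<in> sets hyperplane_borel"
  shows "{\<omega>\<in>space M. finite (X \<omega> \<inter> A) \<and> card (X \<omega> \<inter> A) = m} \<in> events"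
proof -
  have "{\<omega>\<in>space M. finite (X \<omega> \<inter> A) \<and> card (X \<omega> \<inter> A) = m} =
      X -` {\<H> \<in> space hyperplane_systems. finite (\<H> \<inter> A) \<and> card (\<H> \<inter> A) = m} \<inter> space M"
    using measurable_space[OF measurable_process] by auto
  then show ?thesis
    using measurable_sets[OF measurable_process sets_hyperplane_systems_count[OF assms]] by simp
qed

lemma prob_count:
  assumes "A \<in> fmeasurable \<Theta>"
  shows "prob {\<omega>\<in>space M. finite (X \<omega> \<inter> A) \<and> card (X \<omega> \<inter> A) = m} =
    exp (- measure \<Theta> A) * measure \<Theta> A ^ m / fact m"
proof -
  have A: "A \<in> sets hyperplane_borel" "emeasure \<Theta> A < \<infinity>"
    using assms by (auto simp: fmeasurable_def)
  then show ?thesis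
    using poisson by (simp add: poisson_hyperplane_process_def emeasure_intensity measure_def)
qed

lemma indep_events_restrictions:
  fixes F :: "nat \<Rightarrow> 'a set set"
  assumes F: "range F \<subseteq> sets hyperplane_borel" "disjoint_family F"
    and S: "\<And>i. {\<H> \<in> space hyperplane_systems. P i \<H>} \<in> sets hyperplane_systems"
  shows "indep_events (\<lambda>i. {\<omega>\<in>space M. P i (X \<omega> \<inter> F i)}) UNIV"
proof (rule indep_eventsI_indep_vars[where N = "\<lambda>_. hyperplane_systems"])
  show "indep_vars (\<lambda>_. hyperplane_systems) (\<lambda>i \<omega>. X \<omega> \<inter> F i) UNIV"
    using poisson F by (simp add: poisson_hyperplane_process_def)
qed (rule S)

text \<open>The probability that a hyperplane of \<open>D k\<close> is present, \<open>1 - exp (- measure \<Theta> (D k))\<close>, is at most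
  the expected number of such hyperplanes, so the Borel--Cantelli lemma applies.\<close>

lemma finitely_many_overlaps:
  assumes D: "\<And>k::nat. D k \<in> fmeasurable \<Theta>" and sm: "summable (\<lambda>k. measure \<Theta> (D k))"
  shows "AE \<omega> in M. \<forall>\<^sub>F k in sequentially. X \<omega> \<inter> D k = {}"
proof -
  define N where "N k = space M - {\<omega>\<in>space M. finite (X \<omega> \<inter> D k) \<and> card (X \<omega> \<inter> D k) = 0}" for k
  have Dm: "D k \<in> sets hyperplane_borel" for k using D[of k] by (auto simp: fmeasurable_def)
  have Nm: "N k \<in> events" for k unfolding N_def using count_event[OF Dm] by auto
  have le: "prob (N k) \<le> measure \<Theta> (D k)" for k
  proof -
    have "prob (N k) = 1 - exp (- measure \<Theta> (D k))"
      unfolding N_def using prob_compl[OF count_event[OF Dm]] prob_count[OF D, of k 0] by simp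
    then show ?thesis using exp_ge_add_one_self[of "- measure \<Theta> (D k)"] by linarith
  qed
  have "summable (\<lambda>k. prob (N k))"
    by (rule summable_comparison_test'[OF sm]) (use le in simp)
  then have "AE \<omega> in M. \<forall>\<^sub>F k in sequentially. \<omega> \<in> space M - N k"
    using Nm by (intro borel_cantelli_AE1) (auto simp: emeasure_eq_measure)
  then show ?thesis
  proof eventually_elim
    case (elim \<omega>)
    then show ?case by eventually_elim (auto simp: N_def)
  qed
qed

text \<open>Inside \<open>B k\<close> the configuration asks for exactly one hyperplane in each \<open>A k i\<close> and for no other
  hyperplane. Different \<open>B k\<close> may overlap, so these configurations are not independent. Removing
  from \<open>B k\<close> the part \<open>D k\<close> shared with earlier sets makes them so, and costs little: the measures
  of the \<open>D k\<close> are summable, whence almost surely only finitely many \<open>D k\<close> contain a hyperplane.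
  The reduced configurations have probabilities bounded below by the Poisson formula, and the
  zero-one law for independent events yields infinitely many of them.\<close>

proposition infinitely_many_configurations:
  fixes A :: "nat \<Rightarrow> nat \<Rightarrow> 'a set set" and B :: "nat \<Rightarrow> 'a set set"
  assumes B: "\<And>k. B k \<in> fmeasurable \<Theta>" "\<And>k. measure \<Theta> (B k) \<le> C"
    and A: "\<And>k i. i < n \<Longrightarrow> A k i \<in> sets hyperplane_borel" "\<And>k i. i < n \<Longrightarrow> A k i \<subseteq> B k"
    and disj: "\<And>k. disjoint_family_on (A k) {..<n}"
    and c: "c > 0" "\<And>k i. i < n \<Longrightarrow> c \<le> measure \<Theta> (A k i)"
    and sm: "summable (\<lambda>k. measure \<Theta> (B k \<inter> (\<Union>j<k. B j)))"
  shows "AE \<omega> in M. infinite {k. (\<forall>i<n. card (X \<omega> \<inter> A k i) = 1) \<and> X \<omega> \<inter> B k \<subseteq> (\<Union>i<n. A k i)}"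
proof -
  define D where "D k = B k \<inter> (\<Union>j<k. B j)" for k
  have Bs: "B k \<in> sets \<Theta>" for k using B(1) by blast
  have Ds: "D k \<in> sets \<Theta>" for k unfolding D_def using Bs by (intro sets.Int sets.finite_UN) auto
  have D: "D k \<in> fmeasurable \<Theta>" for k
    by (rule fmeasurableI2[OF B(1)[of k] _ Ds]) (auto simp: D_def)
  \<comment> \<open>Besides the reduced sets, \<open>F k n\<close> is the remainder, which has to stay empty; together they
    exhaust \<open>B k - D k\<close>.\<close>
  define F where "F k i = (if i < n then A k i - D k
      else if i = n then B k - D k - (\<Union>i<n. A k i) else {})" for k i
  have Fs: "F k i \<in> sets \<Theta>" for k i
    unfolding F_def using A(1) Bs Ds by (auto intro!: sets.Diff sets.finite_UN)
  have FB: "F k i \<subseteq> B k - D k" for k i unfolding F_def using A(2) by auto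
  have Ff: "F k i \<in> fmeasurable \<Theta>" for k i
    by (rule fmeasurableI2[OF B(1)[of k] _ Fs]) (use FB in auto)
  have FC: "measure \<Theta> (F k i) \<le> C" for k i
    using measure_mono_fmeasurable[OF _ Fs B(1), of k i] FB[of k i] B(2)[of k] by force
  have disjF: "disjoint_family (F k)" for k
    using disj[of k] by (auto simp: disjoint_family_on_def F_def split: if_splits)
  have disjB: "disjoint_family (\<lambda>k. B k - D k)"
  proof -
    have "(B j - D j) \<inter> (B k - D k) = {}" if "j < k" for j k
      using that by (auto simp: D_def)
    then show ?thesis unfolding disjoint_family_on_def by (metis Int_commute linorder_neqE_nat)
  qed
  define m :: "nat \<Rightarrow> nat" where "m i = (if i < n then 1 else 0)" for i
  define P where "P k \<H> \<longleftrightarrow> (\<forall>i\<in>{..n}. finite (\<H> \<inter> F k i) \<and> card (\<H> \<inter> F k i) = m i)" for k \<H>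
  have PB: "P k (X \<omega> \<inter> (B k - D k)) \<longleftrightarrow> P k (X \<omega>)" for k \<omega>
  proof -
    have "X \<omega> \<inter> (B k - D k) \<inter> F k i = X \<omega> \<inter> F k i" for i using FB by blast
    then show ?thesis by (simp add: P_def)
  qed
  have indep: "indep_events (\<lambda>k. {\<omega>\<in>space M. P k (X \<omega>)}) UNIV"
  proof -
    have "indep_events (\<lambda>k. {\<omega>\<in>space M. P k (X \<omega> \<inter> (B k - D k))}) UNIV"
    proof (rule indep_events_restrictions[OF _ disjB])
      show "range (\<lambda>k. B k - D k) \<subseteq> sets hyperplane_borel" using Bs Ds by auto
      show "{\<H> \<in> space hyperplane_systems. P k \<H>} \<in> sets hyperplane_systems" for k
        unfolding P_def using Fs
        by (intro sets.sets_Collect_finite_All' sets_hyperplane_systems_count) auto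
    qed
    then show ?thesis by (simp add: PB)
  qed
  have Pm: "{\<omega>\<in>space M. P k (X \<omega>)} \<in> events" for k
    using indep unfolding indep_events_def by blast
  have prod: "prob {\<omega>\<in>space M. P k (X \<omega>)} =
      (\<Prod>i\<in>{..n}. exp (- measure \<Theta> (F k i)) * measure \<Theta> (F k i) ^ m i)" for k
  proof -
    let ?Q = "\<lambda>i \<H>. finite (\<H> \<inter> F k i) \<and> card (\<H> \<inter> F k i) = m i"
    let ?E = "\<lambda>i. {\<omega>\<in>space M. ?Q i (X \<omega>)}"
    have "indep_events (\<lambda>i. {\<omega>\<in>space M. ?Q i (X \<omega> \<inter> F k i)}) UNIV"
    proof (rule indep_events_restrictions[OF _ disjF])
      show "range (F k) \<subseteq> sets hyperplane_borel" using Fs by auto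
      show "{\<H> \<in> space hyperplane_systems. ?Q i \<H>} \<in> sets hyperplane_systems" for i
        using Fs by (intro sets_hyperplane_systems_count) auto
    qed
    then have "indep_events ?E UNIV" by (simp add: Int_assoc)
    then have "prob (\<Inter>i\<in>{..n}. ?E i) = (\<Prod>i\<in>{..n}. prob (?E i))"
      unfolding indep_events_def by blast
    moreover have "{\<omega>\<in>space M. P k (X \<omega>)} = (\<Inter>i\<in>{..n}. ?E i)" by (auto simp: P_def)
    ultimately have "prob {\<omega>\<in>space M. P k (X \<omega>)} = (\<Prod>i\<in>{..n}. prob (?E i))" by simp
    also have "\<dots> = (\<Prod>i\<in>{..n}. exp (- measure \<Theta> (F k i)) * measure \<Theta> (F k i) ^ m i)"
      by (intro prod.cong refl) (subst prob_count[OF Ff], simp add: m_def)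
    finally show ?thesis .
  qed
  \<comment> \<open>A common lower bound for the Poisson probabilities of the counts 0 and 1 in a set of measure at
    most \<open>C\<close>, which in the case of count 1 has measure at least \<open>c / 2\<close>.\<close>
  define p where "p = exp (- C) * min 1 (c / 2)"
  have p: "p > 0" using c(1) by (simp add: p_def)
  have "(\<lambda>k. measure \<Theta> (D k)) \<longlonglongrightarrow> 0" using summable_LIMSEQ_zero[OF sm] by (simp add: D_def)
  then have "\<forall>\<^sub>F k in sequentially. measure \<Theta> (D k) < c / 2"
    by (rule order_tendstoD) (use c in simp)
  then have low: "\<forall>\<^sub>F k in sequentially. p ^ Suc n \<le> prob {\<omega>\<in>space M. P k (X \<omega>)}"
  proof eventually_elim
    case (elim k)
    have "p \<le> exp (- measure \<Theta> (F k i)) * measure \<Theta> (F k i) ^ m i" if "i \<in> {..n}" for i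
      unfolding p_def
    proof (intro mult_mono)
      show "exp (- C) \<le> exp (- measure \<Theta> (F k i))" using FC by simp
      show "min 1 (c / 2) \<le> measure \<Theta> (F k i) ^ m i"
      proof (cases "i < n")
        case True
        have "measure \<Theta> (A k i) \<le> measure \<Theta> (F k i \<union> D k)"
          using True A(1) by (intro measure_mono_fmeasurable fmeasurable.Un Ff D) (auto simp: F_def)
        also have "\<dots> \<le> measure \<Theta> (F k i) + measure \<Theta> (D k)"
          using Ff D by (intro measure_Un_le) (auto simp: fmeasurable_def)
        finally show ?thesis using True c(2)[OF True, of k] elim by (simp add: m_def)
      qed (simp add: m_def)
    qed (use c in auto)
    then have "(\<Prod>i\<in>{..n}. p) \<le> (\<Prod>i\<in>{..n}. exp (- measure \<Theta> (F k i)) * measure \<Theta> (F k i) ^ m i)"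
      using p by (intro prod_mono) auto
    then show ?case by (simp add: prod)
  qed
  have "AE \<omega> in M. infinite {k. P k (X \<omega>)}"
    using borel_0_1_law_AE[OF indep] not_AE_finitely_often[OF Pm _ low] p by auto
  moreover have "AE \<omega> in M. \<forall>\<^sub>F k in sequentially. X \<omega> \<inter> D k = {}"
    using sm by (intro finitely_many_overlaps D) (simp add: D_def)
  ultimately show ?thesis
  proof eventually_elim
    case (elim \<omega>)
    then obtain k0 where k0: "\<And>k. k \<ge> k0 \<Longrightarrow> X \<omega> \<inter> D k = {}"
      by (auto simp: eventually_sequentially)
    have "{k. P k (X \<omega>)} - {..<k0} \<subseteq>
        {k. (\<forall>i<n. card (X \<omega> \<inter> A k i) = 1) \<and> X \<omega> \<inter> B k \<subseteq> (\<Union>i<n. A k i)}"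
    proof
      fix k assume "k \<in> {k. P k (X \<omega>)} - {..<k0}"
      then have k: "P k (X \<omega>)" "k \<notin> {..<k0}" by auto
      have D0: "X \<omega> \<inter> D k = {}" using k0 k(2) by auto
      have "card (X \<omega> \<inter> A k i) = 1" if "i < n" for i
      proof -
        have "X \<omega> \<inter> A k i = X \<omega> \<inter> F k i" using D0 that by (auto simp: F_def)
        moreover have "card (X \<omega> \<inter> F k i) = 1" using k(1) that by (simp add: P_def m_def)
        ultimately show ?thesis by simp
      qed
      moreover have "finite (X \<omega> \<inter> F k n) \<and> card (X \<omega> \<inter> F k n) = 0"
        using k(1) unfolding P_def m_def by (metis atMost_iff less_irrefl order_refl)
      then have "X \<omega> \<inter> F k n = {}" by (metis card_0_eq)
      then have "X \<omega> \<inter> B k \<subseteq> (\<Union>i<n. A k i)" using D0 by (auto simp: F_def)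
      ultimately show "k \<in> {k. (\<forall>i<n. card (X \<omega> \<inter> A k i) = 1) \<and> X \<omega> \<inter> B k \<subseteq> (\<Union>i<n. A k i)}"
        by blast
    qed
    moreover have "infinite ({k. P k (X \<omega>)} - {..<k0})" using elim(1) by simp
    ultimately show ?case using finite_subset by blast
  qed
qed

end


section \<open>Open sets of hyperplanes and their intensity\<close>

text \<open>Intersecting with the sphere makes every open subset of the ambient product space usable as a
  set of parameters.\<close>

definition hyperplanes_of :: "('a::euclidean_space \<times> real) set \<Rightarrow> 'a set set" where
  "hyperplanes_of G = case_prod hyperplane_at ` (G \<inter> sphere 0 1 \<times> UNIV)"

text \<open>The component of \<open>v\<close> orthogonal to \<open>u\<close> is a direction of the common hyperplane, hence orthogonal
  to \<open>v\<close>, hence zero.\<close>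

lemma hyperplane_at_eq_iff:
  fixes u v :: "'a::euclidean_space"
  assumes u: "norm u = 1" and v: "norm v = 1"
  shows "hyperplane_at u s = hyperplane_at v t \<longleftrightarrow> (v, t) = (u, s) \<or> (v, t) = (- u, - s)"
proof
  assume eq: "hyperplane_at u s = hyperplane_at v t"
  have uu: "u \<bullet> u = 1" and vv: "v \<bullet> v = 1" using u v by (simp_all add: norm_eq_1)
  have mem: "u \<bullet> x = s \<longleftrightarrow> v \<bullet> x = t" for x
    using eq unfolding hyperplane_at_eq[OF u] hyperplane_at_eq[OF v] by blast
  have 1: "v \<bullet> (s *\<^sub>R u) = t" using mem[of "s *\<^sub>R u"] uu by simp
  define w where "w = v - (v \<bullet> u) *\<^sub>R u"
  have uw: "u \<bullet> w = 0" by (simp add: w_def inner_diff_right uu inner_commute)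
  have "v \<bullet> (s *\<^sub>R u + w) = t"
    using mem[of "s *\<^sub>R u + w"] uw uu by (simp add: inner_add_right)
  then have "v \<bullet> w = 0" using 1 by (simp add: inner_add_right)
  then have "w \<bullet> w = 0" using uw by (simp add: w_def inner_diff_left)
  then have vu: "v = (v \<bullet> u) *\<^sub>R u" by (simp add: w_def)
  define k where "k = v \<bullet> u"
  have vk: "v = k *\<^sub>R u" using vu by (simp add: k_def)
  have "\<bar>k\<bar> = 1" using v u unfolding vk by simp
  then have "k = 1 \<or> k = -1" by linarith
  moreover have "t = k * s" using 1 by (simp add: k_def mult.commute)
  ultimately show "(v, t) = (u, s) \<or> (v, t) = (- u, - s)" using vk by auto
next
  assume "(v, t) = (u, s) \<or> (v, t) = (- u, - s)"
  then show "hyperplane_at u s = hyperplane_at v t"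
    unfolding hyperplane_at_eq[OF u] hyperplane_at_eq[OF v] by auto
qed

lemma hyperplane_at_in_hyperplanes_of:
  assumes "norm u = 1"
  shows "hyperplane_at u t \<in> hyperplanes_of G \<longleftrightarrow> (u, t) \<in> G \<or> (- u, - t) \<in> G"
proof
  assume "hyperplane_at u t \<in> hyperplanes_of G"
  then obtain v s where vs: "(v, s) \<in> G" "norm v = 1" "hyperplane_at u t = hyperplane_at v s"
    by (auto simp: hyperplanes_of_def)
  then show "(u, t) \<in> G \<or> (- u, - t) \<in> G"
    using hyperplane_at_eq_iff[OF assms vs(2), of t s] by auto
next
  have eq: "hyperplane_at (- u) (- t) = hyperplane_at u t"
    using hyperplane_at_eq_iff[of u "- u" t "- t"] assms by simp
  assume "(u, t) \<in> G \<or> (- u, - t) \<in> G"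
  then show "hyperplane_at u t \<in> hyperplanes_of G"
  proof
    assume "(u, t) \<in> G"
    then show ?thesis using assms unfolding hyperplanes_of_def by (intro image_eqI[of _ _ "(u, t)"]) auto
  next
    assume "(- u, - t) \<in> G"
    then show ?thesis using assms eq unfolding hyperplanes_of_def by (intro image_eqI[of _ _ "(- u, - t)"]) auto
  qed
qed

lemma hyperplanes_of_subset: "hyperplanes_of G \<subseteq> hyperplanes"
  unfolding hyperplanes_of_def hyperplanes_eq_image by (rule image_mono) auto

text \<open>The preimage under the parametrization is the union of \<open>G\<close> and its reflection \<open>- G\<close>,
  restricted to unit vectors.\<close>

lemma openin_hyperplanes_of:
  fixes G :: "('a::euclidean_space \<times> real) set"
  assumes "open G"
  shows "openin hyperplane_topology (hyperplanes_of G)"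
proof -
  let ?S = "sphere (0::'a) 1 \<times> (UNIV :: real set)"
  have "{p \<in> ?S. case_prod hyperplane_at p \<in> hyperplanes_of G} = ?S \<inter> (G \<union> uminus -` G)"
    by (auto simp: hyperplane_at_in_hyperplanes_of)
  moreover have "open (uminus -` G)"
    by (intro open_vimage assms continuous_intros)
  ultimately show ?thesis
    unfolding openin_hyperplane_topology using hyperplanes_of_subset assms
    by (metis openin_open open_Un)
qed

lemma openin_hyperplane_topology_subset:
  "{U. openin hyperplane_topology U} \<subseteq> Pow hyperplanes"
  using openin_subset[of hyperplane_topology] unfolding topspace_hyperplane_topology by blast

lemma hyperplanes_of_borel:
  assumes "open G"
  shows "hyperplanes_of G \<in> sets hyperplane_borel"
  unfolding hyperplane_borel_def using openin_hyperplanes_of[OF assms] openin_hyperplane_topology_subset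
  by (subst sets_measure_of) auto

text \<open>The generating open sets of hyperplanes have relatively open preimages, by definition of the
  quotient topology.\<close>

lemma measurable_hyperplane_at:
  fixes \<phi> :: "'a::euclidean_space measure"
  assumes \<phi>: "sets \<phi> = sets (restrict_space borel (sphere 0 1))"
  shows "case_prod hyperplane_at \<in> \<phi> \<Otimes>\<^sub>M lborel \<rightarrow>\<^sub>M hyperplane_borel"
proof -
  let ?S = "sphere (0::'a) 1 \<times> (UNIV :: real set)"
  have sp: "space \<phi> = sphere 0 1"
    using sets_eq_imp_space_eq[OF \<phi>] by (simp add: space_restrict_space)
  then have spp: "space (\<phi> \<Otimes>\<^sub>M lborel) = ?S" by (simp add: space_pair_measure)
  have idm: "(\<lambda>x. x) \<in> \<phi> \<rightarrow>\<^sub>M borel"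
    using measurable_restrict_space1[of "\<lambda>x. x" borel borel "sphere (0::'a) 1"]
      measurable_cong_sets[OF \<phi> refl, of borel] by auto
  then have "(\<lambda>p. (fst p, snd p)) \<in> \<phi> \<Otimes>\<^sub>M lborel \<rightarrow>\<^sub>M borel \<Otimes>\<^sub>M borel"
    by (intro measurable_Pair measurable_compose[OF measurable_fst idm]
        measurable_compose[OF measurable_snd, of "\<lambda>x. x"]) auto
  then have emb: "(\<lambda>p. p) \<in> \<phi> \<Otimes>\<^sub>M lborel \<rightarrow>\<^sub>M (borel :: ('a \<times> real) measure)"
    by (simp add: borel_prod)
  show ?thesis
    unfolding hyperplane_borel_def
  proof (rule measurable_measure_of[OF openin_hyperplane_topology_subset])
    show "case_prod hyperplane_at \<in> space (\<phi> \<Otimes>\<^sub>M lborel) \<rightarrow> hyperplanes"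
      unfolding spp hyperplanes_eq_image by blast
    fix U :: "'a set set" assume "U \<in> {U. openin hyperplane_topology U}"
    then have "openin (top_of_set ?S) {p \<in> ?S. case_prod hyperplane_at p \<in> U}"
      unfolding openin_hyperplane_topology by blast
    then obtain W where W: "open W" "{p \<in> ?S. case_prod hyperplane_at p \<in> U} = ?S \<inter> W"
      unfolding openin_open by blast
    then have "case_prod hyperplane_at -` U \<inter> space (\<phi> \<Otimes>\<^sub>M lborel) = (\<lambda>p. p) -` W \<inter> space (\<phi> \<Otimes>\<^sub>M lborel)"
      unfolding spp by blast
    then show "case_prod hyperplane_at -` U \<inter> space (\<phi> \<Otimes>\<^sub>M lborel) \<in> sets (\<phi> \<Otimes>\<^sub>M lborel)"
      using measurable_sets[OF emb] W(1) by simp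
  qed
qed

text \<open>The measure with the disintegration \<open>\<gamma> \<integral> \<integral> 1\<^sub>A (u\<^sup>\<bottom> + t u) dt \<phi>(du)\<close>, obtained as an image of a
  product measure.\<close>

definition intensity_measure :: "real \<Rightarrow> 'a::euclidean_space measure \<Rightarrow> 'a set measure" where
  "intensity_measure \<gamma> \<phi> =
     scale_measure (ennreal \<gamma>) (distr (\<phi> \<Otimes>\<^sub>M lborel) hyperplane_borel (case_prod hyperplane_at))"

lemma sets_intensity_measure: "sets (intensity_measure \<gamma> \<phi>) = sets hyperplane_borel"
  by (simp add: intensity_measure_def)

lemma emeasure_intensity_measure:
  fixes \<phi> :: "'a::euclidean_space measure"
  assumes \<phi>: "sets \<phi> = sets (restrict_space borel (sphere 0 1))" and A: "A \<in> sets hyperplane_borel"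
  shows "emeasure (intensity_measure \<gamma> \<phi>) A =
    ennreal \<gamma> * (\<integral>\<^sup>+u. emeasure lborel {t. hyperplane_at u t \<in> A} \<partial>\<phi>)"
    "u \<in> space \<phi> \<Longrightarrow> {t. hyperplane_at u t \<in> A} \<in> sets lborel"
proof -
  let ?V = "case_prod hyperplane_at -` A \<inter> space (\<phi> \<Otimes>\<^sub>M lborel)"
  have V: "?V \<in> sets (\<phi> \<Otimes>\<^sub>M lborel)" by (rule measurable_sets[OF measurable_hyperplane_at[OF \<phi>] A])
  have slice: "Pair u -` ?V = {t. hyperplane_at u t \<in> A}" if "u \<in> space \<phi>" for u
    using that by (auto simp: space_pair_measure)
  show "{t. hyperplane_at u t \<in> A} \<in> sets lborel" if "u \<in> space \<phi>"
    using sets_Pair1[OF V, of u] slice[OF that] by simp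
  have "emeasure (intensity_measure \<gamma> \<phi>) A = ennreal \<gamma> * emeasure (\<phi> \<Otimes>\<^sub>M lborel) ?V"
    using A by (simp add: intensity_measure_def emeasure_distr[OF measurable_hyperplane_at[OF \<phi>]])
  also have "emeasure (\<phi> \<Otimes>\<^sub>M lborel) ?V = (\<integral>\<^sup>+u. emeasure lborel (Pair u -` ?V) \<partial>\<phi>)"
    by (rule lborel.emeasure_pair_measure_alt[OF V])
  also have "\<dots> = (\<integral>\<^sup>+u. emeasure lborel {t. hyperplane_at u t \<in> A} \<partial>\<phi>)"
    by (intro nn_integral_cong) (simp only: slice)
  finally show "emeasure (intensity_measure \<gamma> \<phi>) A =
    ennreal \<gamma> * (\<integral>\<^sup>+u. emeasure lborel {t. hyperplane_at u t \<in> A} \<partial>\<phi>)" .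
qed

text \<open>Parameters of the hyperplanes that meet the open ball with centre \<open>z\<close> and radius \<open>R\<close>.\<close>

definition slab :: "'a::euclidean_space \<Rightarrow> real \<Rightarrow> ('a \<times> real) set" where
  "slab z R = {(u, t). \<bar>t - u \<bullet> z\<bar> < R}"

text \<open>Parameters of the translates by \<open>z\<close> of the hyperplanes that are close to the one with normal \<open>a\<close>
  and offset \<open>b\<close>.\<close>

definition box_around :: "'a::euclidean_space \<Rightarrow> real \<Rightarrow> real \<Rightarrow> 'a \<Rightarrow> ('a \<times> real) set" where
  "box_around a b \<epsilon> z = {(u, t). norm (u - a) < \<epsilon> \<and> \<bar>t - u \<bullet> z - b\<bar> < \<epsilon>}"

lemma open_slab: "open (slab z R)"
  unfolding slab_def case_prod_unfold by (intro open_Collect_less continuous_intros)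

lemma open_box_around: "open (box_around a b \<epsilon> z)"
  unfolding box_around_def case_prod_unfold by (intro open_Collect_conj open_Collect_less continuous_intros)

lemma hyperplane_at_in_slab:
  "norm u = 1 \<Longrightarrow> hyperplane_at u t \<in> hyperplanes_of (slab z R) \<longleftrightarrow> \<bar>t - u \<bullet> z\<bar> < R"
  by (auto simp: hyperplane_at_in_hyperplanes_of slab_def)

lemma meets_ball_in_slab:
  assumes H: "H \<in> hyperplanes" and "H \<inter> ball z R \<noteq> {}"
  shows "H \<in> hyperplanes_of (slab z R)"
proof -
  obtain u t where u: "norm u = 1" "H = hyperplane_at u t"
    using H unfolding hyperplanes_eq_image by auto
  obtain y where y: "u \<bullet> y = t" "dist z y < R"
  proof -
    obtain y where "y \<in> H" "y \<in> ball z R" using assms(2) by blast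
    then show ?thesis using that u by (simp add: hyperplane_at_eq)
  qed
  have "\<bar>t - u \<bullet> z\<bar> = \<bar>u \<bullet> (y - z)\<bar>" using y(1) by (simp add: inner_diff_right)
  also have "\<dots> \<le> norm u * norm (y - z)" by (rule Cauchy_Schwarz_ineq2)
  also have "\<dots> < R" using u y(2) by (simp add: dist_norm norm_minus_commute)
  finally show ?thesis using u by (simp add: hyperplane_at_in_slab)
qed

lemma emeasure_interval_around:
  fixes c r :: real
  assumes "r \<ge> 0"
  shows "emeasure lborel {t. \<bar>t - c\<bar> < r} = ennreal (2 * r)"
proof -
  have "{t. \<bar>t - c\<bar> < r} = {c - r<..<c + r}" by auto
  then show ?thesis using assms by simp
qed

locale directed_intensity = prob_space \<phi>
  for \<phi> :: "'a::euclidean_space measure" +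
  fixes \<gamma> :: real
  assumes sets_direction: "sets \<phi> = sets (restrict_space borel (sphere 0 1))"
    and gamma: "\<gamma> > 0"
begin

lemma space_direction: "space \<phi> = sphere 0 1"
  using sets_eq_imp_space_eq[OF sets_direction] by (simp add: space_restrict_space)

lemma direction_sets: "A \<in> sets borel \<Longrightarrow> A \<inter> sphere 0 1 \<in> sets \<phi>"
  unfolding sets_direction by (subst sets_restrict_space_iff) auto

lemma measure_slab:
  assumes "R \<ge> 0"
  shows "hyperplanes_of (slab z R) \<in> fmeasurable (intensity_measure \<gamma> \<phi>)"
    "measure (intensity_measure \<gamma> \<phi>) (hyperplanes_of (slab z R)) = \<gamma> * (2 * R)"
proof -
  have s: "hyperplanes_of (slab z R) \<in> sets hyperplane_borel" by (rule hyperplanes_of_borel[OF open_slab])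
  have "(\<integral>\<^sup>+u. emeasure lborel {t. hyperplane_at u t \<in> hyperplanes_of (slab z R)} \<partial>\<phi>) =
      (\<integral>\<^sup>+u. ennreal (2 * R) \<partial>\<phi>)"
    using assms by (intro nn_integral_cong)
      (simp add: space_direction hyperplane_at_in_slab emeasure_interval_around)
  then have e: "emeasure (intensity_measure \<gamma> \<phi>) (hyperplanes_of (slab z R)) = ennreal (\<gamma> * (2 * R))"
    using gamma assms
    by (simp add: emeasure_intensity_measure(1)[OF sets_direction s] emeasure_space_1 ennreal_mult)
  then show "hyperplanes_of (slab z R) \<in> fmeasurable (intensity_measure \<gamma> \<phi>)"
    using s by (intro fmeasurableI) (simp_all add: sets_intensity_measure)
  show "measure (intensity_measure \<gamma> \<phi>) (hyperplanes_of (slab z R)) = \<gamma> * (2 * R)"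
    using e gamma assms by (simp add: measure_def)
qed

text \<open>A hyperplane that meets both balls has a normal vector nearly orthogonal to \<open>z - w\<close>, at least
  if the balls are far apart; this is what turns distance into approximate independence.\<close>

lemma measure_slab_Int_le:
  assumes "R \<ge> 0"
  shows "measure (intensity_measure \<gamma> \<phi>) (hyperplanes_of (slab z R) \<inter> hyperplanes_of (slab w R)) \<le>
    \<gamma> * (2 * R) * prob ({u. \<bar>u \<bullet> (z - w)\<bar> < 2 * R} \<inter> sphere 0 1)"
proof -
  let ?A = "hyperplanes_of (slab z R) \<inter> hyperplanes_of (slab w R)"
  let ?E = "{u. \<bar>u \<bullet> (z - w)\<bar> < 2 * R} \<inter> sphere 0 1"
  have s: "?A \<in> sets hyperplane_borel" by (intro sets.Int hyperplanes_of_borel open_slab)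
  have E: "?E \<in> sets \<phi>" by (intro direction_sets) measurable
  have "(\<integral>\<^sup>+u. emeasure lborel {t. hyperplane_at u t \<in> ?A} \<partial>\<phi>) \<le> (\<integral>\<^sup>+u. ennreal (2 * R) * indicator ?E u \<partial>\<phi>)"
  proof (intro nn_integral_mono)
    fix u assume "u \<in> space \<phi>"
    then have u: "norm u = 1" "u \<in> sphere 0 1" by (auto simp: space_direction)
    show "emeasure lborel {t. hyperplane_at u t \<in> ?A} \<le> ennreal (2 * R) * indicator ?E u"
    proof (cases "u \<in> ?E")
      case True
      have "emeasure lborel {t. hyperplane_at u t \<in> ?A} \<le> emeasure lborel {t. \<bar>t - u \<bullet> z\<bar> < R}"
        using u(1) by (intro emeasure_mono) (auto simp: hyperplane_at_in_slab)
      then show ?thesis using True assms by (simp add: emeasure_interval_around)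
    next
      case False
      then have "2 * R \<le> \<bar>u \<bullet> z - u \<bullet> w\<bar>" using u(2) by (auto simp: inner_diff_right)
      then have empty: "{t. hyperplane_at u t \<in> ?A} = {}" using u(1) by (auto simp: hyperplane_at_in_slab)
      show ?thesis unfolding empty by simp
    qed
  qed
  also have "\<dots> = ennreal (2 * R * prob ?E)"
    using E assms by (simp add: nn_integral_cmult_indicator emeasure_eq_measure ennreal_mult)
  finally have "emeasure (intensity_measure \<gamma> \<phi>) ?A \<le> ennreal \<gamma> * ennreal (2 * R * prob ?E)"
    unfolding emeasure_intensity_measure(1)[OF sets_direction s] by (rule mult_left_mono) simp
  also have "\<dots> = ennreal (\<gamma> * (2 * R) * prob ?E)"
    using gamma assms by (simp add: ennreal_mult mult.assoc)
  finally show ?thesis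
    unfolding measure_def using gamma assms by (intro enn2real_leI) auto
qed

text \<open>For a direction within \<open>\<epsilon>\<close> of \<open>a\<close>, the admissible offsets form an interval of length \<open>2 * \<epsilon>\<close>
  wherever \<open>z\<close> lies; hence one bound serves for all translations.\<close>

lemma measure_box_around_ge:
  assumes "\<epsilon> > 0" and sub: "box_around a b \<epsilon> z \<subseteq> slab z R"
  shows "\<gamma> * (2 * \<epsilon> * prob (ball a \<epsilon> \<inter> sphere 0 1)) \<le>
    measure (intensity_measure \<gamma> \<phi>) (hyperplanes_of (box_around a b \<epsilon> z))"
proof -
  let ?A = "hyperplanes_of (box_around a b \<epsilon> z)" and ?E = "ball a \<epsilon> \<inter> sphere 0 1"
  have s: "?A \<in> sets hyperplane_borel" by (intro hyperplanes_of_borel open_box_around)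
  have E: "?E \<in> sets \<phi>" by (intro direction_sets) measurable
  have AR: "?A \<subseteq> hyperplanes_of (slab z (max 0 R))"
    using sub unfolding hyperplanes_of_def by (intro image_mono) (auto simp: slab_def)
  have f: "?A \<in> fmeasurable (intensity_measure \<gamma> \<phi>)"
    by (rule fmeasurableI2[OF measure_slab(1) AR]) (use s in \<open>simp_all add: sets_intensity_measure\<close>)
  have "(\<integral>\<^sup>+u. ennreal (2 * \<epsilon>) * indicator ?E u \<partial>\<phi>) \<le> (\<integral>\<^sup>+u. emeasure lborel {t. hyperplane_at u t \<in> ?A} \<partial>\<phi>)"
  proof (intro nn_integral_mono)
    fix u assume us: "u \<in> space \<phi>"
    then have u: "norm u = 1" by (auto simp: space_direction)
    show "ennreal (2 * \<epsilon>) * indicator ?E u \<le> emeasure lborel {t. hyperplane_at u t \<in> ?A}"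
    proof (cases "u \<in> ?E")
      case True
      have "{t. \<bar>t - (u \<bullet> z + b)\<bar> < \<epsilon>} \<subseteq> {t. hyperplane_at u t \<in> ?A}"
        using u True
        by (auto simp: hyperplane_at_in_hyperplanes_of box_around_def dist_norm norm_minus_commute algebra_simps)
      then have "emeasure lborel {t. \<bar>t - (u \<bullet> z + b)\<bar> < \<epsilon>} \<le> emeasure lborel {t. hyperplane_at u t \<in> ?A}"
        by (intro emeasure_mono emeasure_intensity_measure(2)[OF sets_direction s us])
      then show ?thesis using True assms by (simp add: emeasure_interval_around)
    qed simp
  qed
  then have "ennreal \<gamma> * (\<integral>\<^sup>+u. ennreal (2 * \<epsilon>) * indicator ?E u \<partial>\<phi>) \<le> emeasure (intensity_measure \<gamma> \<phi>) ?A"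
    unfolding emeasure_intensity_measure(1)[OF sets_direction s] by (intro mult_left_mono) auto
  moreover have "ennreal \<gamma> * (\<integral>\<^sup>+u. ennreal (2 * \<epsilon>) * indicator ?E u \<partial>\<phi>) = ennreal (\<gamma> * (2 * \<epsilon> * prob ?E))"
    using E assms gamma by (simp add: nn_integral_cmult_indicator emeasure_eq_measure ennreal_mult)
  ultimately show ?thesis
    using emeasure_eq_measure2[OF f] by (simp add: ennreal_le_iff)
qed

text \<open>As \<open>s\<close> grows, the neighbourhoods shrink to the great subsphere orthogonal to \<open>e\<close>.\<close>

lemma prob_near_great_subsphere:
  assumes null: "emeasure \<phi> ({u. e \<bullet> u = 0} \<inter> sphere 0 1) = 0" and "\<delta> > 0"
  shows "\<exists>s\<ge>s0. prob ({u. \<bar>u \<bullet> e\<bar> * s < r} \<inter> sphere 0 1) < \<delta>"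
proof -
  define E where "E k = {u. \<bar>u \<bullet> e\<bar> * real k < r} \<inter> sphere 0 1" for k
  have E: "E k \<in> sets \<phi>" for k unfolding E_def by (intro direction_sets) measurable
  have dec: "decseq E"
    unfolding decseq_def E_def
    by (auto elim!: order.strict_trans1[rotated] intro!: mult_left_mono)
  have "(\<lambda>k. prob (E k)) \<longlonglongrightarrow> prob (\<Inter>k. E k)"
    using E dec by (intro finite_Lim_measure_decseq) auto
  moreover have "prob (\<Inter>k. E k) = 0"
  proof -
    have "(\<Inter>k. E k) \<subseteq> {u. e \<bullet> u = 0} \<inter> sphere 0 1"
    proof
      fix u assume u: "u \<in> (\<Inter>k. E k)"
      have "u \<bullet> e = 0"
      proof (rule ccontr)
        assume "u \<bullet> e \<noteq> 0"
        then obtain k :: nat where "r < real k * \<bar>u \<bullet> e\<bar>"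
          using reals_Archimedean3[of "\<bar>u \<bullet> e\<bar>"] by auto
        moreover have "u \<in> E k" using u by blast
        ultimately show False by (simp add: E_def mult.commute)
      qed
      then show "u \<in> {u. e \<bullet> u = 0} \<inter> sphere 0 1" using u by (auto simp: E_def inner_commute)
    qed
    moreover have "{u. e \<bullet> u = 0} \<inter> sphere 0 1 \<in> sets \<phi>" by (intro direction_sets) measurable
    ultimately have "prob (\<Inter>k. E k) \<le> prob ({u. e \<bullet> u = 0} \<inter> sphere 0 1)"
      by (rule finite_measure_mono)
    moreover have "prob ({u. e \<bullet> u = 0} \<inter> sphere 0 1) = 0" using null by (simp add: measure_def)
    ultimately show ?thesis using measure_nonneg[of \<phi> "\<Inter>k. E k"] by linarith
  qed
  ultimately have "\<forall>\<^sub>F k in sequentially. prob (E k) < \<delta>"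
    using assms(2) by (auto dest: order_tendstoD)
  moreover have "\<forall>\<^sub>F k in sequentially. s0 \<le> real k"
    using filterlim_real_sequentially by (auto simp: filterlim_at_top)
  ultimately have "\<forall>\<^sub>F k in sequentially. prob (E k) < \<delta> \<and> s0 \<le> real k" by eventually_elim simp
  then obtain k where "prob (E k) < \<delta> \<and> s0 \<le> real k"
    using eventually_happens' sequentially_bot by blast
  then show ?thesis by (intro exI[of _ "real k"]) (simp add: E_def)
qed

end


section \<open>Every simple type appears infinitely often\<close>

text \<open>The gaps of the sequence are chosen one after another: partial sums of the \<open>s k\<close> have distances
  from all earlier sums at least \<open>s k\<close>.\<close>

lemma sparse_translations:
  fixes q :: "real \<Rightarrow> real" and \<delta> :: "nat \<Rightarrow> real"
  assumes q: "\<And>s t. s \<le> t \<Longrightarrow> q t \<le> q s"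
    and small: "\<And>s0 d. d > 0 \<Longrightarrow> \<exists>s\<ge>s0. q s < d" and \<delta>: "\<And>k. \<delta> k > 0" and r: "r \<ge> 0"
  obtains t :: "nat \<Rightarrow> real" where "\<And>j k. j < k \<Longrightarrow> r \<le> t k - t j" "\<And>j k. j < k \<Longrightarrow> q (t k - t j) \<le> \<delta> k"
proof -
  have "\<exists>s. \<forall>k. s k \<ge> r \<and> q (s k) < \<delta> k"
    using small[OF \<delta>] by (intro choice) blast
  then obtain s where s: "\<And>k. s k \<ge> r" "\<And>k. q (s k) < \<delta> k" by blast
  define t where "t k = (\<Sum>i\<le>k. s i)" for k
  have gap: "s k \<le> t k - t j" if "j < k" for j k
  proof -
    have "t j + s k = (\<Sum>i\<in>insert k {..j}. s i)" using that by (simp add: t_def)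
    also have "\<dots> \<le> t k"
      unfolding t_def using that s(1) r by (intro sum_mono2) (auto intro: order_trans)
    finally show ?thesis by simp
  qed
  show ?thesis
  proof (rule that)
    show "r \<le> t k - t j" if "j < k" for j k using gap[OF that] s(1)[of k] by linarith
    show "q (t k - t j) \<le> \<delta> k" if "j < k" for j k
      using q[OF gap[OF that]] s(2)[of k] by linarith
  qed
qed

text \<open>Only finitely many pairs of distinct hyperplanes have to be separated, and the translation
  does not change the distances that matter. Both descriptions of a hyperplane have to be kept
  apart, so antipodal pairs must be excluded as well.\<close>

lemma separated_boxes:
  fixes a :: "nat \<Rightarrow> 'a::euclidean_space" and b :: "nat \<Rightarrow> real"
  assumes inj: "\<And>i j. i < n \<Longrightarrow> j < n \<Longrightarrow> (a i, b i) = (a j, b j) \<Longrightarrow> i = j"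
    and anti: "\<And>i j. i < n \<Longrightarrow> j < n \<Longrightarrow> (a i, b i) \<noteq> (- a j, - b j)"
  shows "\<forall>\<^sub>F \<epsilon> in at_right 0. \<forall>z. disjoint_family_on
    (\<lambda>i. hyperplanes_of (box_around (a i) (b i) \<epsilon> z)) {..<n}"
proof -
  \<comment> \<open>Two points close to \<open>(u, t)\<close> differ by less than \<open>2 * \<epsilon>\<close> in each of the two components.\<close>
  have far: "\<forall>\<^sub>F \<epsilon> in at_right (0::real). 4 * \<epsilon> < dist (a i, b i) p" if "(a i, b i) \<noteq> p" for i p
  proof -
    have "((\<lambda>\<epsilon>::real. 4 * \<epsilon>) \<longlongrightarrow> 4 * 0) (at_right 0)" by (intro tendsto_intros)
    then show ?thesis using that by (intro order_tendstoD(2)[of _ "4 * 0"]) auto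
  qed
  have "\<forall>\<^sub>F \<epsilon> in at_right (0::real). \<forall>i\<in>{..<n}. \<forall>j\<in>{..<n}.
      (i \<noteq> j \<longrightarrow> 4 * \<epsilon> < dist (a i, b i) (a j, b j)) \<and> 4 * \<epsilon> < dist (a i, b i) (- a j, - b j)"
  proof (intro eventually_ball_finite ballI eventually_conj)
    fix i j assume ij: "i \<in> {..<n}" "j \<in> {..<n}"
    show "\<forall>\<^sub>F \<epsilon> in at_right 0. i \<noteq> j \<longrightarrow> 4 * \<epsilon> < dist (a i, b i) (a j, b j)"
    proof (cases "i = j")
      case False
      then have "(a i, b i) \<noteq> (a j, b j)" using inj ij by blast
      from far[OF this] show ?thesis by (rule eventually_mono) simp
    qed simp
    show "\<forall>\<^sub>F \<epsilon> in at_right 0. 4 * \<epsilon> < dist (a i, b i) (- a j, - b j)"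
      using ij by (intro far anti) auto
  qed auto
  then show ?thesis
  proof eventually_elim
    case (elim \<epsilon>)
    have False if ij: "i < n" "j < n" "i \<noteq> j"
      and H: "H \<in> hyperplanes_of (box_around (a i) (b i) \<epsilon> z)" "H \<in> hyperplanes_of (box_around (a j) (b j) \<epsilon> z)"
      for i j H z
    proof -
      obtain u t where u: "norm u = 1" "H = hyperplane_at u t" and
        1: "norm (u - a i) < \<epsilon>" "\<bar>t - u \<bullet> z - b i\<bar> < \<epsilon>"
        using H(1) by (auto simp: hyperplanes_of_def box_around_def)
      have pair_dist: "dist (a i, b i) (c, d) < 4 * \<epsilon>"
        if "norm (u - c) < \<epsilon>" "\<bar>t - u \<bullet> z - d\<bar> < \<epsilon>" for c d
      proof -
        have "dist (a i, b i) (c, d) \<le> dist (a i) c + dist (b i) d"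
          by (simp add: dist_Pair_Pair sqrt_sum_squares_le_sum)
        moreover have "dist (a i) c \<le> norm (u - a i) + norm (u - c)"
          using dist_triangle2[of "a i" c u] by (simp add: dist_norm norm_minus_commute)
        moreover have "dist (b i) d \<le> \<bar>t - u \<bullet> z - b i\<bar> + \<bar>t - u \<bullet> z - d\<bar>" by (simp add: dist_real_def)
        ultimately show ?thesis using 1 that by linarith
      qed
      have "(u, t) \<in> box_around (a j) (b j) \<epsilon> z \<or> (- u, - t) \<in> box_around (a j) (b j) \<epsilon> z"
        using H(2) u by (simp add: hyperplane_at_in_hyperplanes_of)
      then show False
      proof
        assume "(u, t) \<in> box_around (a j) (b j) \<epsilon> z"
        then have "dist (a i, b i) (a j, b j) < 4 * \<epsilon>" by (intro pair_dist) (auto simp: box_around_def)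
        then show False using elim ij by force
      next
        assume "(- u, - t) \<in> box_around (a j) (b j) \<epsilon> z"
        then have "norm (- u - a j) < \<epsilon>" "\<bar>- t - - u \<bullet> z - b j\<bar> < \<epsilon>" by (auto simp: box_around_def)
        moreover have "norm (- u - a j) = norm (u - - a j)" by (metis minus_diff_eq diff_minus_eq_add norm_minus_cancel add.commute diff_conv_add_uminus)
        ultimately have "dist (a i, b i) (- a j, - b j) < 4 * \<epsilon>" by (intro pair_dist) auto
        then show False using elim ij by force
      qed
    qed
    then show ?case unfolding disjoint_family_on_def by blast
  qed
qed

text \<open>The hyperplanes found in the boxes, moved back by \<open>- z\<close>, are a small perturbation of the system
  \<open>(a, b)\<close>, so they bound a polytope of type \<open>\<V>\<close> inside the ball; as no other hyperplane meets
  the ball, this polytope is a cell.\<close>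

lemma cell_of_configuration:
  fixes a :: "nat \<Rightarrow> 'a::euclidean_space"
  assumes near: "\<And>a' b'. \<forall>i<n. norm (a' i - a i) < \<epsilon> \<and> \<bar>b' i - b i\<bar> < \<epsilon> \<Longrightarrow>
      incidences {..<n} a' b' = \<V> \<and> hpoly {..<n} a' b' \<subseteq> ball 0 R \<and> (\<forall>i<n. a' i \<bullet> x < b' i)"
    and \<H>: "\<H> \<subseteq> hyperplanes"
    and one: "\<And>i. i < n \<Longrightarrow> card (\<H> \<inter> hyperplanes_of (box_around (a i) (b i) \<epsilon> z)) = 1"
    and none: "\<H> \<inter> hyperplanes_of (slab z R) \<subseteq> (\<Union>i<n. hyperplanes_of (box_around (a i) (b i) \<epsilon> z))"
  obtains a' b' where "hpoly {..<n} a' b' \<in> cells \<H>" "hpoly {..<n} a' b' \<subseteq> ball z R"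
    "hpoly {..<n} a' b' \<noteq> {}" "incidences {..<n} a' b' = \<V>"
proof -
  let ?A = "\<lambda>i. hyperplanes_of (box_around (a i) (b i) \<epsilon> z)"
  have "\<exists>p. i < n \<longrightarrow> p \<in> box_around (a i) (b i) \<epsilon> z \<and> norm (fst p) = 1 \<and>
      \<H> \<inter> ?A i = {hyperplane_at (fst p) (snd p)}" for i
  proof (cases "i < n")
    case True
    then obtain H where H: "\<H> \<inter> ?A i = {H}" using one card_1_singletonE by blast
    then have "H \<in> ?A i" by blast
    then obtain p where "p \<in> box_around (a i) (b i) \<epsilon> z \<inter> sphere 0 1 \<times> UNIV" "H = case_prod hyperplane_at p"
      unfolding hyperplanes_of_def by blast
    then show ?thesis using H by (intro exI[of _ p]) (auto simp: case_prod_unfold mem_Times_iff)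
  qed simp
  then obtain p where p: "\<And>i. i < n \<Longrightarrow> p i \<in> box_around (a i) (b i) \<epsilon> z \<and> norm (fst (p i)) = 1 \<and>
      \<H> \<inter> ?A i = {hyperplane_at (fst (p i)) (snd (p i))}"
    by metis
  define u s where "u i = fst (p i)" and "s i = snd (p i) - u i \<bullet> z" for i
  have snd_p: "snd (p i) = s i + u i \<bullet> z" for i by (simp add: s_def)
  have H: "\<H> \<inter> ?A i = {{y. u i \<bullet> y = s i + u i \<bullet> z}}" if "i < n" for i
    using p[OF that] hyperplane_at_eq[of "u i" "snd (p i)"] by (simp add: u_def[symmetric] snd_p)
  have "\<forall>i<n. norm (u i - a i) < \<epsilon> \<and> \<bar>s i - b i\<bar> < \<epsilon>"
    using p by (auto simp: box_around_def u_def s_def case_prod_unfold)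
  note nb = near[OF this]
  let ?Q = "hpoly {..<n} u (\<lambda>i. s i + u i \<bullet> z)"
  have Q: "?Q = (+) z ` hpoly {..<n} u s" by (rule hpoly_translation)
  have sub: "?Q \<subseteq> ball z R"
    using nb unfolding Q by (auto simp: dist_norm)
  show ?thesis
  proof (rule that)
    show "?Q \<in> cells \<H>"
    proof (rule hpoly_in_cells[OF _ _ sub])
      show "u i \<bullet> (x + z) < s i + u i \<bullet> z" if "i \<in> {..<n}" for i
        using nb that by (simp add: inner_add_right)
      show "{y. u i \<bullet> y = s i + u i \<bullet> z} \<in> \<H>" if "i \<in> {..<n}" for i using H[of i] that by blast
      show "\<exists>i\<in>{..<n}. K = {y. u i \<bullet> y = s i + u i \<bullet> z}" if K: "K \<in> \<H>" "K \<inter> ball z R \<noteq> {}" for K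
      proof -
        have "K \<in> \<H> \<inter> hyperplanes_of (slab z R)" using meets_ball_in_slab K \<H> by blast
        then obtain i where "i < n" "K \<in> \<H> \<inter> ?A i" using none K(1) by blast
        then show ?thesis using H[of i] by blast
      qed
    qed simp
    show "?Q \<subseteq> ball z R" by (rule sub)
    have "x \<in> hpoly {..<n} u s" using nb by (auto simp: hpoly_def intro: less_imp_le)
    then show "?Q \<noteq> {}" unfolding Q by blast
    show "incidences {..<n} u (\<lambda>i. s i + u i \<bullet> z) = \<V>"
      using nb by (simp add: incidences_translation)
  qed
qed

text \<open>The configurations of \<open>cell_of_configuration\<close> are placed at points \<open>z k\<close> on one line, with gaps so
  large that the balls are disjoint, which makes the resulting cells distinct, and that the expected
  number of hyperplanes meeting the \<open>k\<close>-th and an earlier ball is at most \<open>(1 / 2) ^ k\<close>.\<close>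

lemma infinitely_many_cells_of_type:
  fixes a :: "nat \<Rightarrow> 'a::euclidean_space" and b :: "nat \<Rightarrow> real"
    and X :: "'w \<Rightarrow> 'a set set" and \<phi> :: "'a measure"
  assumes X: "poisson_hyperplanes M X (intensity_measure \<gamma> \<phi>)" and dir: "directed_intensity \<phi> \<gamma>"
    and supp: "measure_support \<phi> = sphere 0 1"
    and null: "\<And>u. u \<in> sphere 0 1 \<Longrightarrow> emeasure \<phi> ({x. u \<bullet> x = 0} \<inter> sphere 0 1) = 0"
    and unit: "\<And>i. i < n \<Longrightarrow> norm (a i) = 1"
    and bd: "bounded (hpoly {..<n} a b)" and x: "\<And>i. i < n \<Longrightarrow> a i \<bullet> x < b i"
    and simple: "\<And>v. v extreme_point_of hpoly {..<n} a b \<Longrightarrow> card (active {..<n} a b v) = DIM('a)"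
    and inj: "\<And>i j. i < n \<Longrightarrow> j < n \<Longrightarrow> (a i, b i) = (a j, b j) \<Longrightarrow> i = j"
    and anti: "\<And>i j. i < n \<Longrightarrow> j < n \<Longrightarrow> (a i, b i) \<noteq> (- a j, - b j)"
  shows "AE \<omega> in M. infinite {C \<in> cells (X \<omega>). has_incidences (incidences {..<n} a b) C}"
proof -
  interpret X: poisson_hyperplanes M X "intensity_measure \<gamma> \<phi>" by (rule X)
  interpret D: directed_intensity \<phi> \<gamma> by (rule dir)
  let ?\<Theta> = "intensity_measure \<gamma> \<phi>" and ?N = "{..<n}"
  obtain R0 where R0: "hpoly ?N a b \<subseteq> ball 0 R0" using bd bounded_subset_ballD by blast
  \<comment> \<open>Large enough also for hyperplanes in boxes of size less than 1 to meet the ball.\<close>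
  define R where "R = \<bar>R0\<bar> + (\<Sum>i<n. \<bar>b i\<bar>) + 1"
  have "0 \<le> (\<Sum>i<n. \<bar>b i\<bar>)" by (intro sum_nonneg) auto
  then have "R0 \<le> R" and R: "R > 0" unfolding R_def by linarith+
  then have sub: "hpoly ?N a b \<subseteq> ball 0 R" using R0 subset_ball[of R0 R 0] by blast
  have bR: "\<bar>b i\<bar> + 1 \<le> R" if "i < n" for i
    unfolding R_def using member_le_sum[of i "{..<n}" "\<lambda>i. \<bar>b i\<bar>"] that by simp
  have "\<forall>\<^sub>F (a', b') in nearby ?N a b. incidences ?N a' b' = incidences ?N a b \<and>
      hpoly ?N a' b' \<subseteq> ball 0 R \<and> (\<forall>i<n. a' i \<bullet> x < b' i)"
  proof -
    have "\<forall>\<^sub>F (a', b') in nearby ?N a b. incidences ?N a' b' = incidences ?N a b"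
      by (rule nearby_incidences_eq[OF _ _ bd simple]) (use x in auto)
    moreover have "\<forall>\<^sub>F (a', b') in nearby ?N a b. hpoly ?N a' b' \<subseteq> ball 0 R"
      by (rule nearby_subset_ball[OF _ _ sub]) (use x in auto)
    moreover have "\<forall>\<^sub>F (a', b') in nearby ?N a b. \<forall>i\<in>?N. a' i \<bullet> x < b' i"
      by (rule nearby_strictly_feasible) (use x in auto)
    ultimately show ?thesis by eventually_elim auto
  qed
  then obtain \<epsilon>0 where \<epsilon>0: "\<epsilon>0 > 0" "\<And>a' b'. \<forall>i<n. norm (a' i - a i) < \<epsilon>0 \<and> \<bar>b' i - b i\<bar> < \<epsilon>0 \<Longrightarrow>
      incidences ?N a' b' = incidences ?N a b \<and> hpoly ?N a' b' \<subseteq> ball 0 R \<and> (\<forall>i<n. a' i \<bullet> x < b' i)"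
    unfolding eventually_nearby prod.case Ball_def lessThan_iff by blast
  have "\<forall>\<^sub>F \<epsilon> in at_right 0. (\<forall>z. disjoint_family_on
      (\<lambda>i. hyperplanes_of (box_around (a i) (b i) \<epsilon> z)) ?N) \<and> 0 < \<epsilon> \<and> \<epsilon> < min \<epsilon>0 1"
    by (intro eventually_conj separated_boxes inj anti eventually_at_right_less
        order_tendstoD(2)[OF tendsto_ident_at]) (use \<epsilon>0 in auto)
  then obtain \<epsilon> where "(\<forall>z. disjoint_family_on (\<lambda>i. hyperplanes_of (box_around (a i) (b i) \<epsilon> z)) ?N) \<and>
      0 < \<epsilon> \<and> \<epsilon> < min \<epsilon>0 1"
    by (rule eventually_happens'[OF trivial_limit_at_right_real, THEN exE])
  then have \<epsilon>: "\<And>z. disjoint_family_on (\<lambda>i. hyperplanes_of (box_around (a i) (b i) \<epsilon> z)) ?N"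
      "0 < \<epsilon>" "\<epsilon> < \<epsilon>0" "\<epsilon> < 1"
    by auto

  have box_slab: "box_around (a i) (b i) \<epsilon> z \<subseteq> slab z R" if "i < n" for i z
    using bR[OF that] \<epsilon>(4) by (auto simp: box_around_def slab_def)
  \<comment> \<open>The element 1 keeps the set nonempty in the case \<open>n = 0\<close>.\<close>
  define c where "c = Min (insert 1 ((\<lambda>i. \<gamma> * (2 * \<epsilon> * D.prob (ball (a i) \<epsilon> \<inter> sphere 0 1))) ` ?N))"
  have c: "c > 0"
  proof -
    have "D.prob (ball (a i) \<epsilon> \<inter> sphere 0 1) > 0" if "i < n" for i
    proof -
      have "a i \<in> measure_support \<phi>" using supp unit[OF that] by simp
      moreover have "a i \<in> ball (a i) \<epsilon>" using \<epsilon>(2) by simp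
      ultimately have "emeasure \<phi> (ball (a i) \<epsilon> \<inter> sphere 0 1) > 0"
        unfolding measure_support_def D.space_direction using open_ball by blast
      then show ?thesis by (simp add: D.emeasure_eq_measure)
    qed
    then show ?thesis unfolding c_def using D.gamma \<epsilon>(2) by (subst Min_gr_iff) auto
  qed
  have c_le: "c \<le> measure ?\<Theta> (hyperplanes_of (box_around (a i) (b i) \<epsilon> z))" if "i < n" for i z
  proof -
    have "c \<le> \<gamma> * (2 * \<epsilon> * D.prob (ball (a i) \<epsilon> \<inter> sphere 0 1))"
      unfolding c_def using that by (intro Min_le) auto
    also have "\<dots> \<le> measure ?\<Theta> (hyperplanes_of (box_around (a i) (b i) \<epsilon> z))"
      by (rule D.measure_box_around_ge[OF \<epsilon>(2) box_slab[OF that]])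
    finally show ?thesis .
  qed

  obtain e :: 'a where e: "norm e = 1" using norm_Basis nonempty_Basis by blast
  let ?q = "\<lambda>s. D.prob ({u. \<bar>u \<bullet> e\<bar> * s < 2 * R} \<inter> sphere 0 1)"
  \<comment> \<open>Chosen so that at most \<open>k\<close> overlaps, each at most \<open>\<gamma> * (2 * R) * ?d k\<close>, add up to at most
    \<open>(1 / 2) ^ k\<close>.\<close>
  let ?d = "\<lambda>k. (1 / 2) ^ k / (real (Suc k) * (\<gamma> * (2 * R)))"
  obtain t :: "nat \<Rightarrow> real" where t: "\<And>j k. j < k \<Longrightarrow> 2 * R \<le> t k - t j" "\<And>j k. j < k \<Longrightarrow> ?q (t k - t j) \<le> ?d k"
  proof (rule sparse_translations[of ?q ?d "2 * R"])
    show "?q t \<le> ?q s" if "s \<le> t" for s t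
    proof (rule D.finite_measure_mono)
      show "{u. \<bar>u \<bullet> e\<bar> * t < 2 * R} \<inter> sphere 0 1 \<subseteq> {u. \<bar>u \<bullet> e\<bar> * s < 2 * R} \<inter> sphere 0 1"
        using that by (auto elim!: order.strict_trans1[rotated] intro!: mult_left_mono)
      show "{u. \<bar>u \<bullet> e\<bar> * s < 2 * R} \<inter> sphere 0 1 \<in> sets \<phi>"
        by (intro D.direction_sets) measurable
    qed
    show "\<exists>s\<ge>s0. ?q s < d" if "d > 0" for s0 d
      using D.prob_near_great_subsphere[of e d s0 "2 * R", OF null that] e by auto
    show "?d k > 0" for k using R D.gamma by simp
  qed (use R in auto)
  define z where "z k = t k *\<^sub>R e" for k
  define B where "B k = hyperplanes_of (slab (z k) R)" for k
  define A where "A k i = hyperplanes_of (box_around (a i) (b i) \<epsilon> (z k))" for k i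
  have overlap: "measure ?\<Theta> (B k \<inter> (\<Union>j<k. B j)) \<le> (1 / 2) ^ k" for k
  proof -
    have BB: "B k \<inter> B j \<in> fmeasurable ?\<Theta>" for j
      unfolding B_def using R by (intro fmeasurable_Int_fmeasurable D.measure_slab(1))
        (auto simp: sets_intensity_measure intro: hyperplanes_of_borel open_slab)
    have "measure ?\<Theta> (B k \<inter> (\<Union>j<k. B j)) = measure ?\<Theta> (\<Union>j<k. B k \<inter> B j)" by (simp only: Int_UN_distrib)
    also have "\<dots> \<le> (\<Sum>j<k. measure ?\<Theta> (B k \<inter> B j))"
      by (intro measure_UNION_le fmeasurableD BB) simp
    also have "\<dots> \<le> (\<Sum>j<k. \<gamma> * (2 * R) * ?d k)"
    proof (rule sum_mono)
      fix j assume "j \<in> {..<k}"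
      then have j: "j < k" by simp
      have "{u. \<bar>u \<bullet> (z k - z j)\<bar> < 2 * R} = {u. \<bar>u \<bullet> e\<bar> * (t k - t j) < 2 * R}"
        using t(1)[OF j] R by (simp add: z_def scaleR_diff_left[symmetric] abs_mult mult.commute)
      then have "measure ?\<Theta> (B k \<inter> B j) \<le> \<gamma> * (2 * R) * ?q (t k - t j)"
        using D.measure_slab_Int_le[of R "z k" "z j"] R by (simp add: B_def)
      also have "\<dots> \<le> \<gamma> * (2 * R) * ?d k"
        using t(2)[OF j] R D.gamma by (intro mult_left_mono) auto
      finally show "measure ?\<Theta> (B k \<inter> B j) \<le> \<gamma> * (2 * R) * ?d k" .
    qed
    also have "\<dots> = real k / real (Suc k) * (1 / 2) ^ k"
    proof -
      have "d * (x / (y * d)) = x / y" if "d \<noteq> 0" for d x y :: real using that by simp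
      from this[of "\<gamma> * (2 * R)" "(1 / 2) ^ k" "real (Suc k)"] show ?thesis
        using R D.gamma by (simp only: sum_constant card_lessThan) simp
    qed
    also have "\<dots> \<le> 1 * (1 / 2) ^ k" by (intro mult_right_mono) auto
    finally show ?thesis by simp
  qed
  have "AE \<omega> in M. infinite {k. (\<forall>i<n. card (X \<omega> \<inter> A k i) = 1) \<and> X \<omega> \<inter> B k \<subseteq> (\<Union>i<n. A k i)}"
  proof (rule X.infinitely_many_configurations)
    show "B k \<in> fmeasurable ?\<Theta>" "measure ?\<Theta> (B k) \<le> \<gamma> * (2 * R)" for k
      unfolding B_def using D.measure_slab[of R "z k"] R by auto
    show "A k i \<in> sets hyperplane_borel" for k i
      unfolding A_def by (rule hyperplanes_of_borel[OF open_box_around])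
    show "A k i \<subseteq> B k" if "i < n" for k i
      unfolding A_def B_def hyperplanes_of_def using box_slab[OF that] by (intro image_mono) blast
    show "disjoint_family_on (A k) ?N" for k unfolding A_def by (rule \<epsilon>(1))
    show "c > 0" "\<And>k i. i < n \<Longrightarrow> c \<le> measure ?\<Theta> (A k i)" using c c_le by (auto simp: A_def)
    show "summable (\<lambda>k. measure ?\<Theta> (B k \<inter> (\<Union>j<k. B j)))"
      by (rule summable_comparison_test'[of "\<lambda>k. (1 / 2) ^ k" 0]) (use overlap in \<open>auto intro: summable_geometric\<close>)
  qed
  then show ?thesis
    using AE_space
  proof eventually_elim
    case (elim \<omega>)
    let ?K = "{k. (\<forall>i<n. card (X \<omega> \<inter> A k i) = 1) \<and> X \<omega> \<inter> B k \<subseteq> (\<Union>i<n. A k i)}"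
    let ?good = "\<lambda>k C. C \<in> cells (X \<omega>) \<and> C \<subseteq> ball (z k) R \<and> C \<noteq> {} \<and>
      has_incidences (incidences ?N a b) C"
    have good: "\<exists>C. ?good k C" if k: "k \<in> ?K" for k
    proof -
      obtain a' b' where "hpoly ?N a' b' \<in> cells (X \<omega>)" "hpoly ?N a' b' \<subseteq> ball (z k) R"
          "hpoly ?N a' b' \<noteq> {}" "incidences ?N a' b' = incidences ?N a b"
      proof (rule cell_of_configuration[of n a \<epsilon> b "incidences ?N a b" R x "X \<omega>" "z k"])
        show "incidences ?N a' b' = incidences ?N a b \<and> hpoly ?N a' b' \<subseteq> ball 0 R \<and> (\<forall>i<n. a' i \<bullet> x < b' i)"
          if "\<forall>i<n. norm (a' i - a i) < \<epsilon> \<and> \<bar>b' i - b i\<bar> < \<epsilon>" for a' b'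
          using that \<epsilon>(3) by (intro \<epsilon>0(2)) (meson order.strict_trans)
        show "X \<omega> \<subseteq> hyperplanes" using X.process_hyperplanes elim(2) by blast
      qed (use k in \<open>auto simp: A_def B_def\<close>)
      moreover from this(2) have "bounded (hpoly ?N a' b')"
        by (rule bounded_subset[OF bounded_ball])
      ultimately have "?good k (hpoly ?N a' b')"
        unfolding has_incidences_def by (intro conjI exI[of _ ?N] exI[of _ a'] exI[of _ b']) simp_all
      then show ?thesis by (rule exI)
    qed
    have "\<exists>C. \<forall>k\<in>?K. ?good k (C k)"
      by (intro bchoice ballI good)
    then obtain C where "\<forall>k\<in>?K. ?good k (C k)" by (rule exE)
    then have C: "?good k (C k)" if "k \<in> ?K" for k using that by (rule bspec)
    have "inj_on C ?K"
    proof (rule inj_onI, rule ccontr)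
      fix j k assume jk: "j \<in> ?K" "k \<in> ?K" "C j = C k" "j \<noteq> k"
      have "C j \<noteq> {}" "C j \<subseteq> ball (z j) R" "C j \<subseteq> ball (z k) R"
        using C[OF jk(1)] C[OF jk(2)] by (simp_all only: jk(3) simp_thms)
      then obtain y where "y \<in> ball (z j) R" "y \<in> ball (z k) R" by blast
      then have "dist (z j) (z k) < 2 * R" using dist_triangle2[of "z j" "z k" y] by (simp add: dist_commute)
      moreover have "dist (z j) (z k) = \<bar>t k - t j\<bar>"
        using e by (simp add: z_def dist_norm scaleR_diff_left[symmetric])
      ultimately show False using t(1)[of j k] t(1)[of k j] jk(4) by (cases "j < k") auto
    qed
    then have "infinite (C ` ?K)" using elim(1) finite_image_iff[of C ?K] by simp
    moreover have "C ` ?K \<subseteq> {C \<in> cells (X \<omega>). has_incidences (incidences ?N a b) C}"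
      using C by blast
    ultimately show ?case using finite_subset by blast
  qed
qed

theorem theorem2:
  fixes M :: "'w measure"
    and X :: "'w \<Rightarrow> 'a::euclidean_space set set"
    and \<phi> :: "'a measure"
  assumes "poisson_hyperplane_process M X"
    and "stationary M X"
    and "locally_finite_intensity M X"
    and "\<exists>A \<in> sets hyperplane_borel. intensity M X A \<noteq> 0"
    and "spherical_directional_distribution M X \<phi>"
    and "measure_support \<phi> = sphere 0 1"
    and "\<And>u. u \<in> sphere 0 1 \<Longrightarrow> emeasure \<phi> ({x. u \<bullet> x = 0} \<inter> sphere 0 1) = 0"
  shows "AE \<omega> in M. \<forall>P :: 'a set. simple_d_polytope P \<longrightarrow>
           infinite {C \<in> cells (X \<omega>). combinatorially_isomorphic C P}"
proof -
  obtain \<gamma> where \<gamma>: "\<gamma> > 0" "\<And>A. A \<in> sets hyperplane_borel \<Longrightarrow> intensity M X A =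
      ennreal \<gamma> * (\<integral>\<^sup>+u. (\<integral>\<^sup>+\<tau>. indicator A (hyperplane_at u \<tau>) \<partial>lborel) \<partial>\<phi>)"
    and \<phi>: "prob_space \<phi>" "sets \<phi> = sets (restrict_space borel (sphere 0 1))"
    using assms(5) by (auto simp: spherical_directional_distribution_def even_sphere_prob_def)
  have dir: "directed_intensity \<phi> \<gamma>"
    using \<phi> \<gamma>(1) by (simp add: directed_intensity_def directed_intensity_axioms_def)
  have "emeasure (intensity_measure \<gamma> \<phi>) A = intensity M X A" if A: "A \<in> sets hyperplane_borel" for A
    unfolding \<gamma>(2)[OF A] emeasure_intensity_measure(1)[OF \<phi>(2) A]
  proof (intro arg_cong2[where f = "(*)"] refl nn_integral_cong)
    fix u assume u: "u \<in> space \<phi>"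
    have "(\<integral>\<^sup>+\<tau>. indicator A (hyperplane_at u \<tau>) \<partial>lborel) =
        (\<integral>\<^sup>+\<tau>. indicator {t. hyperplane_at u t \<in> A} \<tau> \<partial>lborel)"
      by (simp add: indicator_def)
    then show "emeasure lborel {t. hyperplane_at u t \<in> A} =
        (\<integral>\<^sup>+\<tau>. indicator A (hyperplane_at u \<tau>) \<partial>lborel)"
      using emeasure_intensity_measure(2)[OF \<phi>(2) A u] by (simp add: nn_integral_indicator)
  qed
  then have proc: "poisson_hyperplanes M X (intensity_measure \<gamma> \<phi>)"
    using assms(1) by (simp add: poisson_hyperplanes_def poisson_hyperplanes_axioms_def
        sets_intensity_measure poisson_hyperplane_process_def hyperplane_process_def)
  define T where "T = {\<V> \<in> {\<V> :: nat set set. finite \<V> \<and> \<V> \<subseteq> Collect finite}.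
    AE \<omega> in M. infinite {C \<in> cells (X \<omega>). has_incidences \<V> C}}"
  have "countable T"
    unfolding T_def by (rule countable_subset[OF _ countable_incidence_types]) blast
  then have all_types: "AE \<omega> in M. \<forall>\<V>\<in>T. infinite {C \<in> cells (X \<omega>). has_incidences \<V> C}"
    by (intro AE_ball_countable') (simp_all add: T_def)
  have type: "\<exists>\<V>\<in>T. has_incidences \<V> P" if P: "simple_d_polytope P" for P :: "'a set"
  proof -
    obtain n :: nat and a b x where rep: "P = hpoly {..<n} a b" "\<And>i. i < n \<Longrightarrow> norm (a i) = 1"
      "bounded (hpoly {..<n} a b)" "\<And>i. i < n \<Longrightarrow> a i \<bullet> x < b i"
      "\<And>v. v extreme_point_of hpoly {..<n} a b \<Longrightarrow> card (active {..<n} a b v) = DIM('a)"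
      "\<And>i j. i < n \<Longrightarrow> j < n \<Longrightarrow> (a i, b i) = (a j, b j) \<Longrightarrow> i = j"
      "\<And>i j. i < n \<Longrightarrow> j < n \<Longrightarrow> (a i, b i) \<noteq> (- a j, - b j)"
      by (rule simple_d_polytope_hpoly[OF P]) (rule that)
    have "AE \<omega> in M. infinite {C \<in> cells (X \<omega>). has_incidences (incidences {..<n} a b) C}"
      by (rule infinitely_many_cells_of_type[OF proc dir assms(6) assms(7) rep(2-7)])
    then have "incidences {..<n} a b \<in> T"
      using incidences_in_types[of "{..<n}" a b] unfolding T_def by simp
    moreover have "has_incidences (incidences {..<n} a b) P"
      unfolding has_incidences_def rep(1) using rep(3) finite_lessThan by blast
    ultimately show ?thesis by blast
  qed
  from all_types show ?thesis
  proof eventually_elim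
    case (elim \<omega>)
    show ?case
    proof (intro allI impI)
      fix P :: "'a set" assume "simple_d_polytope P"
      then obtain \<V> where \<V>: "\<V> \<in> T" "has_incidences \<V> P" using type by blast
      have "{C \<in> cells (X \<omega>). has_incidences \<V> C} \<subseteq> {C \<in> cells (X \<omega>). combinatorially_isomorphic C P}"
        using has_incidences_isomorphic \<V>(2) by blast
      then show "infinite {C \<in> cells (X \<omega>). combinatorially_isomorphic C P}"
        using elim \<V>(1) finite_subset by blast
    qed
  qed
qed

end
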